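(* The class of inner anodyne extensions does not have the left cancellation property; that is, there exists a composable pair of monomorphisms of simplicial sets $i \colon A \to B$ and $j \colon B \to C$ such that $j$ and $ji$ are inner anodyne, but such that $i$ is not inner anodyne.
   Context: A morphism of simplicial sets is inner anodyne (or an inner anodyne extension) if it belongs to the saturated class generated by the inner horn inclusions $\Lambda^n_k \to \Delta^n$, $0<k<n$ (the smallest class containing them and closed under pushouts, coproducts, transfinite composition and retracts); equivalently, if it is a retract of a countable composite of pushouts of coproducts of inner horn inclusions. *)

theory Defs
  imports Main "HOL-Library.FuncSet"
begin

section \<open>Simplicial sets\<close>

text \<open>
  The object \<open>[n]\<close> of the simplex category is \<open>{..n}\<close>. Its morphisms are represented by
  extensional functions, so that equality of morphisms is equality of functions.
\<close>

definition Delta_hom :: "nat \<Rightarrow> nat \<Rightarrow> (nat \<Rightarrow> nat) set" where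
  "Delta_hom m n = {\<theta> \<in> {..m} \<rightarrow>\<^sub>E {..n}. mono_on {..m} \<theta>}"

definition Delta_id :: "nat \<Rightarrow> nat \<Rightarrow> nat" where
  "Delta_id n = (\<lambda>i\<in>{..n}. i)"

text \<open>
  \<open>act X m n \<theta>\<close> is the operator from \<open>n\<close>-simplices to \<open>m\<close>-simplices induced by
  \<open>\<theta> : [m] \<rightarrow> [n]\<close>. Its values off \<open>simplices X n\<close> are irrelevant.
\<close>

record 'a sset =
  simplices :: "nat \<Rightarrow> 'a set"
  act :: "nat \<Rightarrow> nat \<Rightarrow> (nat \<Rightarrow> nat) \<Rightarrow> 'a \<Rightarrow> 'a"

definition simplicial_set :: "'a sset \<Rightarrow> bool" where
  "simplicial_set X \<longleftrightarrow>
     (\<forall>m n. \<forall>\<theta>\<in>Delta_hom m n. \<forall>x\<in>simplices X n. act X m n \<theta> x \<in> simplices X m) \<and>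
     (\<forall>n. \<forall>x\<in>simplices X n. act X n n (Delta_id n) x = x) \<and>
     (\<forall>l m n. \<forall>\<eta>\<in>Delta_hom l m. \<forall>\<theta>\<in>Delta_hom m n. \<forall>x\<in>simplices X n.
        act X l n (compose {..l} \<theta> \<eta>) x = act X l m \<eta> (act X m n \<theta> x))"

type_synonym ('a, 'b) smap = "nat \<Rightarrow> 'a \<Rightarrow> 'b"

definition sset_hom :: "'a sset \<Rightarrow> 'b sset \<Rightarrow> ('a, 'b) smap set" where
  "sset_hom X Y = {f. simplicial_set X \<and> simplicial_set Y \<and>
     (\<forall>n. f n \<in> simplices X n \<rightarrow>\<^sub>E simplices Y n) \<and>
     (\<forall>m n. \<forall>\<theta>\<in>Delta_hom m n. \<forall>x\<in>simplices X n.
        f m (act X m n \<theta> x) = act Y m n \<theta> (f n x))}"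

definition smap_id :: "'a sset \<Rightarrow> ('a, 'a) smap" where
  "smap_id X = (\<lambda>n. \<lambda>x\<in>simplices X n. x)"

text \<open>The first argument is the domain of the composite.\<close>

definition smap_comp :: "'a sset \<Rightarrow> ('b, 'c) smap \<Rightarrow> ('a, 'b) smap \<Rightarrow> ('a, 'c) smap" where
  "smap_comp X g f = (\<lambda>n. compose (simplices X n) (g n) (f n))"

definition sset_iso :: "'a sset \<Rightarrow> 'b sset \<Rightarrow> ('a, 'b) smap \<Rightarrow> bool" where
  "sset_iso X Y f \<longleftrightarrow> f \<in> sset_hom X Y \<and>
     (\<exists>g\<in>sset_hom Y X. smap_comp X g f = smap_id X \<and> smap_comp Y f g = smap_id Y)"

definition sset_mono :: "'u sset \<Rightarrow> 'u sset \<Rightarrow> ('u, 'u) smap \<Rightarrow> bool" where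
  "sset_mono X Y f \<longleftrightarrow> f \<in> sset_hom X Y \<and>
     (\<forall>(Z::'u sset). \<forall>g\<in>sset_hom Z X. \<forall>h\<in>sset_hom Z X.
        smap_comp Z f g = smap_comp Z f h \<longrightarrow> g = h)"


section \<open>Standard simplices and horns\<close>

definition std_simplex :: "nat \<Rightarrow> (nat \<Rightarrow> nat) sset" where
  "std_simplex n = \<lparr>simplices = (\<lambda>m. Delta_hom m n),
                    act = (\<lambda>l m \<eta> \<theta>. compose {..l} \<theta> \<eta>)\<rparr>"

text \<open>
  The \<open>k\<close>-th horn is the union of the faces of the standard \<open>n\<close>-simplex opposite to the vertices
  \<open>i \<noteq> k\<close>; a simplex lies on the face opposite to \<open>i\<close> iff it misses the vertex \<open>i\<close>.
\<close>

definition horn :: "nat \<Rightarrow> nat \<Rightarrow> (nat \<Rightarrow> nat) sset" where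
  "horn n k = \<lparr>simplices = (\<lambda>m. {\<theta> \<in> Delta_hom m n. \<exists>i\<le>n. i \<noteq> k \<and> i \<notin> \<theta> ` {..m}}),
               act = (\<lambda>l m \<eta> \<theta>. compose {..l} \<theta> \<eta>)\<rparr>"

text \<open>
  Throughout, the type \<open>'u\<close> plays the role of the universe: the small sets are the subsets of
  \<open>'u\<close>. The horn inclusions are brought into this universe up to isomorphism of arrows.
\<close>

definition inner_horn_inclusion :: "'u sset \<Rightarrow> 'u sset \<Rightarrow> ('u, 'u) smap \<Rightarrow> bool" where
  "inner_horn_inclusion A B f \<longleftrightarrow> f \<in> sset_hom A B \<and>
     (\<exists>n k \<phi> \<psi>. 0 < k \<and> k < n \<and> sset_iso (horn n k) A \<phi> \<and> sset_iso (std_simplex n) B \<psi> \<and>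
        smap_comp (horn n k) f \<phi> = smap_comp (horn n k) \<psi> (smap_id (horn n k)))"


section \<open>Colimits and retracts\<close>

definition is_pushout ::
  "'u sset \<Rightarrow> 'u sset \<Rightarrow> 'u sset \<Rightarrow> 'u sset \<Rightarrow>
   ('u, 'u) smap \<Rightarrow> ('u, 'u) smap \<Rightarrow> ('u, 'u) smap \<Rightarrow> ('u, 'u) smap \<Rightarrow> bool" where
  "is_pushout A B C D f u v g \<longleftrightarrow>
     f \<in> sset_hom A B \<and> u \<in> sset_hom A C \<and> v \<in> sset_hom B D \<and> g \<in> sset_hom C D \<and>
     smap_comp A v f = smap_comp A g u \<and>
     (\<forall>(Z::'u sset). \<forall>p\<in>sset_hom B Z. \<forall>q\<in>sset_hom C Z. smap_comp A p f = smap_comp A q u \<longrightarrow>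
        (\<exists>!h. h \<in> sset_hom D Z \<and> smap_comp B h v = p \<and> smap_comp C h g = q))"

definition is_coproduct ::
  "'i set \<Rightarrow> ('i \<Rightarrow> 'u sset) \<Rightarrow> 'u sset \<Rightarrow> ('i \<Rightarrow> ('u, 'u) smap) \<Rightarrow> bool" where
  "is_coproduct I X S c \<longleftrightarrow>
     simplicial_set S \<and> (\<forall>i\<in>I. c i \<in> sset_hom (X i) S) \<and>
     (\<forall>(Z::'u sset) p. simplicial_set Z \<and> (\<forall>i\<in>I. p i \<in> sset_hom (X i) Z) \<longrightarrow>
        (\<exists>!h. h \<in> sset_hom S Z \<and> (\<forall>i\<in>I. smap_comp (X i) h (c i) = p i)))"

text \<open>
  Colimit of the diagram with objects \<open>X i\<close> and transition maps \<open>t i j : X i \<rightarrow> X j\<close> for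
  \<open>(i, j) \<in> r\<close>, restricted to the indices in \<open>I\<close>.
\<close>

definition is_colimit ::
  "'i set \<Rightarrow> 'i rel \<Rightarrow> ('i \<Rightarrow> 'u sset) \<Rightarrow> ('i \<Rightarrow> 'i \<Rightarrow> ('u, 'u) smap) \<Rightarrow>
   'u sset \<Rightarrow> ('i \<Rightarrow> ('u, 'u) smap) \<Rightarrow> bool" where
  "is_colimit I r X t L c \<longleftrightarrow>
     simplicial_set L \<and> (\<forall>i\<in>I. c i \<in> sset_hom (X i) L) \<and>
     (\<forall>i\<in>I. \<forall>j\<in>I. (i, j) \<in> r \<longrightarrow> smap_comp (X i) (c j) (t i j) = c i) \<and>
     (\<forall>(Z::'u sset) p. simplicial_set Z \<and> (\<forall>i\<in>I. p i \<in> sset_hom (X i) Z) \<and>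
          (\<forall>i\<in>I. \<forall>j\<in>I. (i, j) \<in> r \<longrightarrow> smap_comp (X i) (p j) (t i j) = p i) \<longrightarrow>
        (\<exists>!h. h \<in> sset_hom L Z \<and> (\<forall>i\<in>I. smap_comp (X i) h (c i) = p i)))"

definition is_bottom :: "'i rel \<Rightarrow> 'i \<Rightarrow> bool" where
  "is_bottom r i \<longleftrightarrow> i \<in> Field r \<and> (\<forall>j\<in>Field r. (i, j) \<in> r)"

definition covered_by :: "'i rel \<Rightarrow> 'i \<Rightarrow> 'i \<Rightarrow> bool" where
  "covered_by r i j \<longleftrightarrow>
     (i, j) \<in> r \<and> i \<noteq> j \<and> (\<forall>k. (i, k) \<in> r \<and> (k, j) \<in> r \<longrightarrow> k = i \<or> k = j)"

definition is_limit :: "'i rel \<Rightarrow> 'i \<Rightarrow> bool" where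
  "is_limit r k \<longleftrightarrow> k \<in> Field r \<and> \<not> is_bottom r k \<and> (\<nexists>i. covered_by r i k)"

text \<open>
  A colimit-preserving functor on the ordinal given by the (reflexive) well-order \<open>r\<close>.
\<close>

definition transfinite_sequence ::
  "'i rel \<Rightarrow> ('i \<Rightarrow> 'u sset) \<Rightarrow> ('i \<Rightarrow> 'i \<Rightarrow> ('u, 'u) smap) \<Rightarrow> bool" where
  "transfinite_sequence r X t \<longleftrightarrow> Well_order r \<and>
     (\<forall>i j. (i, j) \<in> r \<longrightarrow> t i j \<in> sset_hom (X i) (X j)) \<and>
     (\<forall>i\<in>Field r. t i i = smap_id (X i)) \<and>
     (\<forall>i j k. (i, j) \<in> r \<and> (j, k) \<in> r \<longrightarrow> smap_comp (X i) (t j k) (t i j) = t i k) \<and>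
     (\<forall>k. is_limit r k \<longrightarrow> is_colimit (underS r k) r X t (X k) (\<lambda>i. t i k))"

definition is_retract ::
  "'u sset \<Rightarrow> 'u sset \<Rightarrow> ('u, 'u) smap \<Rightarrow> 'u sset \<Rightarrow> 'u sset \<Rightarrow> ('u, 'u) smap \<Rightarrow> bool" where
  "is_retract A B f X Y g \<longleftrightarrow> f \<in> sset_hom A B \<and> g \<in> sset_hom X Y \<and>
     (\<exists>a\<in>sset_hom A X. \<exists>p\<in>sset_hom X A. \<exists>b\<in>sset_hom B Y. \<exists>q\<in>sset_hom Y B.
        smap_comp A p a = smap_id A \<and> smap_comp B q b = smap_id B \<and>
        smap_comp A g a = smap_comp A b f \<and> smap_comp X f p = smap_comp X q g)"


section \<open>Saturated classes and inner anodyne extensions\<close>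

type_synonym 'u smap_class = "'u sset \<Rightarrow> 'u sset \<Rightarrow> ('u, 'u) smap \<Rightarrow> bool"

definition closed_under_pushouts :: "'u smap_class \<Rightarrow> bool" where
  "closed_under_pushouts W \<longleftrightarrow>
     (\<forall>A B C D f u v g. W A B f \<and> is_pushout A B C D f u v g \<longrightarrow> W C D g)"

text \<open>
  Small index sets and small ordinals are those represented by subsets of \<open>'u\<close>, respectively by
  well-orders on subsets of \<open>'u\<close>.
\<close>

definition closed_under_coproducts :: "'u smap_class \<Rightarrow> bool" where
  "closed_under_coproducts W \<longleftrightarrow>
     (\<forall>(I::'u set) A B f SA SB a b h.
        (\<forall>i\<in>I. W (A i) (B i) (f i)) \<and> is_coproduct I A SA a \<and> is_coproduct I B SB b \<and>
        h \<in> sset_hom SA SB \<and>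
        (\<forall>i\<in>I. smap_comp (A i) h (a i) = smap_comp (A i) (b i) (f i)) \<longrightarrow>
        W SA SB h)"

definition closed_under_transfinite_composition :: "'u smap_class \<Rightarrow> bool" where
  "closed_under_transfinite_composition W \<longleftrightarrow>
     (\<forall>(r::'u rel) X t L c z.
        transfinite_sequence r X t \<and>
        (\<forall>i j. covered_by r i j \<longrightarrow> W (X i) (X j) (t i j)) \<and>
        is_colimit (Field r) r X t L c \<and> is_bottom r z \<longrightarrow>
        W (X z) L (c z))"

definition closed_under_retracts :: "'u smap_class \<Rightarrow> bool" where
  "closed_under_retracts W \<longleftrightarrow>
     (\<forall>A B f X Y g. W X Y g \<and> is_retract A B f X Y g \<longrightarrow> W A B f)"

definition saturated :: "'u smap_class \<Rightarrow> bool" where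
  "saturated W \<longleftrightarrow>
     (\<forall>A B f. W A B f \<longrightarrow> f \<in> sset_hom A B) \<and>
     closed_under_pushouts W \<and> closed_under_coproducts W \<and>
     closed_under_transfinite_composition W \<and> closed_under_retracts W"

definition inner_anodyne :: "'u smap_class" where
  "inner_anodyne A B f \<longleftrightarrow>
     (\<forall>W. saturated W \<and> (\<forall>A B f. inner_horn_inclusion A B f \<longrightarrow> W A B f) \<longrightarrow> W A B f)"


section \<open>Well-definedness\<close>

lemma Delta_hom_compose:
  assumes "\<eta> \<in> Delta_hom l m" "\<theta> \<in> Delta_hom m n"
  shows "compose {..l} \<theta> \<eta> \<in> Delta_hom l n"
proof -
  have "compose {..l} \<theta> \<eta> \<in> {..l} \<rightarrow>\<^sub>E {..n}"
    using assms by (auto simp: Delta_hom_def compose_def PiE_iff)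
  moreover have "mono_on {..l} (compose {..l} \<theta> \<eta>)"
  proof (rule mono_onI)
    fix x y assume xy: "x \<in> {..l}" "y \<in> {..l}" "x \<le> y"
    have "\<eta> x \<le> \<eta> y" "\<eta> x \<in> {..m}" "\<eta> y \<in> {..m}"
      using assms(1) xy by (auto simp: Delta_hom_def PiE_iff mono_on_def)
    then have "\<theta> (\<eta> x) \<le> \<theta> (\<eta> y)"
      using assms(2) by (auto simp: Delta_hom_def mono_on_def)
    then show "compose {..l} \<theta> \<eta> x \<le> compose {..l} \<theta> \<eta> y"
      using xy by (simp add: compose_def)
  qed
  ultimately show ?thesis by (simp add: Delta_hom_def)
qed

lemma Delta_compose_id:
  assumes "\<theta> \<in> Delta_hom m n" shows "compose {..m} \<theta> (Delta_id m) = \<theta>"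
proof -
  have "\<theta> \<in> extensional {..m}" using assms by (auto simp: Delta_hom_def PiE_def)
  then show ?thesis by (auto simp: compose_def Delta_id_def extensional_def fun_eq_iff)
qed

lemma Delta_compose_assoc:
  assumes "\<zeta> \<in> Delta_hom k l"
  shows "compose {..k} \<theta> (compose {..k} \<eta> \<zeta>) = compose {..k} (compose {..l} \<theta> \<eta>) \<zeta>"
  using assms by (auto simp: compose_def Delta_hom_def PiE_iff fun_eq_iff)

lemma simplicial_set_std_simplex: "simplicial_set (std_simplex n)"
  unfolding simplicial_set_def std_simplex_def sset.simps
  by (intro conjI allI ballI) (simp_all only: Delta_hom_compose Delta_compose_id Delta_compose_assoc)

lemma simplicial_set_horn: "simplicial_set (horn n k)"
proof -
  have img: "i \<notin> compose {..l} \<theta> \<eta> ` {..l}"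
    if "\<eta> \<in> Delta_hom l m" "i \<notin> \<theta> ` {..m}" for i l m :: nat and \<eta> \<theta>
    using that by (auto simp: compose_def Delta_hom_def PiE_iff)
  show ?thesis
    unfolding simplicial_set_def horn_def sset.simps
  proof (intro conjI allI ballI)
    fix l m \<eta> \<theta>
    assume \<eta>: "\<eta> \<in> Delta_hom l m"
      and \<theta>: "\<theta> \<in> {\<theta> \<in> Delta_hom m n. \<exists>i\<le>n. i \<noteq> k \<and> i \<notin> \<theta> ` {..m}}"
    from \<theta> obtain i where "i \<le> n" "i \<noteq> k" "i \<notin> \<theta> ` {..m}" by blast
    with img[OF \<eta>] have "\<exists>i\<le>n. i \<noteq> k \<and> i \<notin> compose {..l} \<theta> \<eta> ` {..l}" by blast
    moreover have "\<theta> \<in> Delta_hom m n" using \<theta> by simp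
    then have "compose {..l} \<theta> \<eta> \<in> Delta_hom l n" by (rule Delta_hom_compose[OF \<eta>])
    ultimately show "compose {..l} \<theta> \<eta> \<in> {\<theta> \<in> Delta_hom l n. \<exists>i\<le>n. i \<noteq> k \<and> i \<notin> \<theta> ` {..l}}"
      by simp
  next
    fix m \<theta>
    assume "\<theta> \<in> {\<theta> \<in> Delta_hom m n. \<exists>i\<le>n. i \<noteq> k \<and> i \<notin> \<theta> ` {..m}}"
    then show "compose {..m} \<theta> (Delta_id m) = \<theta>"
      by (auto intro: Delta_compose_id)
  next
    fix l' l m \<zeta> \<eta> \<theta>
    assume "\<zeta> \<in> Delta_hom l' l"
    then show "compose {..l'} \<theta> (compose {..l'} \<eta> \<zeta>) = compose {..l'} (compose {..l} \<theta> \<eta>) \<zeta>"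
      by (rule Delta_compose_assoc)
  qed
qed

lemma saturated_all: "saturated (\<lambda>A B f. f \<in> sset_hom A B)"
  by (auto simp: saturated_def closed_under_pushouts_def closed_under_coproducts_def
      closed_under_transfinite_composition_def closed_under_retracts_def is_pushout_def
      is_colimit_def is_bottom_def is_retract_def)

lemma inner_anodyne_least:
  assumes "inner_anodyne A B f" "saturated W \<and> (\<forall>A B f. inner_horn_inclusion A B f \<longrightarrow> W A B f)"
  shows "W A B f"
  using assms(1)[unfolded inner_anodyne_def, rule_format, OF assms(2)] .

lemma inner_anodyne_hom:
  assumes "inner_anodyne A B f" shows "f \<in> sset_hom A B"
proof -
  have "\<forall>A B f. inner_horn_inclusion A B f \<longrightarrow> f \<in> sset_hom A B"
    by (auto simp: inner_horn_inclusion_def)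
  then show ?thesis
    using assms saturated_all unfolding inner_anodyne_def by blast
qed

lemma inner_anodyne_horn: "inner_horn_inclusion A B f \<Longrightarrow> inner_anodyne A B f"
  by (auto simp: inner_anodyne_def)

lemma saturated_inner_anodyne: "saturated (inner_anodyne :: 'u smap_class)"
proof -
  have "closed_under_pushouts (inner_anodyne :: 'u smap_class)"
    unfolding closed_under_pushouts_def
  proof (intro allI impI)
    fix A B C D :: "'u sset" and f u v g
    assume a: "inner_anodyne A B f \<and> is_pushout A B C D f u v g"
    show "inner_anodyne C D g" unfolding inner_anodyne_def
    proof (intro allI impI)
      fix W :: "'u smap_class"
      assume W: "saturated W \<and> (\<forall>A B f. inner_horn_inclusion A B f \<longrightarrow> W A B f)"
      have "W A B f" using a inner_anodyne_least[OF _ W] by blast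
      with a W show "W C D g" unfolding saturated_def closed_under_pushouts_def by metis
    qed
  qed
  moreover have "closed_under_coproducts (inner_anodyne :: 'u smap_class)"
    unfolding closed_under_coproducts_def
  proof (intro allI impI)
    fix I :: "'u set" and A B f and SA SB :: "'u sset" and a b h
    assume a: "(\<forall>i\<in>I. inner_anodyne (A i) (B i) (f i)) \<and>
        is_coproduct I A SA a \<and> is_coproduct I B SB b \<and> h \<in> sset_hom SA SB \<and>
        (\<forall>i\<in>I. smap_comp (A i) h (a i) = smap_comp (A i) (b i) (f i))"
    show "inner_anodyne SA SB h" unfolding inner_anodyne_def
    proof (intro allI impI)
      fix W :: "'u smap_class"
      assume W: "saturated W \<and> (\<forall>A B f. inner_horn_inclusion A B f \<longrightarrow> W A B f)"
      have i: "\<forall>i\<in>I. W (A i) (B i) (f i)"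
        using a inner_anodyne_least[OF _ W] by blast
      from W have "closed_under_coproducts W" by (simp add: saturated_def)
      from this[unfolded closed_under_coproducts_def, rule_format, of I A B f SA a SB b h] i a
      show "W SA SB h" by blast
    qed
  qed
  moreover have "closed_under_transfinite_composition (inner_anodyne :: 'u smap_class)"
    unfolding closed_under_transfinite_composition_def
  proof (intro allI impI)
    fix r :: "'u rel" and X t and L :: "'u sset" and c z
    assume a: "transfinite_sequence r X t \<and>
        (\<forall>i j. covered_by r i j \<longrightarrow> inner_anodyne (X i) (X j) (t i j)) \<and>
        is_colimit (Field r) r X t L c \<and> is_bottom r z"
    show "inner_anodyne (X z) L (c z)" unfolding inner_anodyne_def
    proof (intro allI impI)
      fix W :: "'u smap_class"
      assume W: "saturated W \<and> (\<forall>A B f. inner_horn_inclusion A B f \<longrightarrow> W A B f)"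
      have i: "\<forall>i j. covered_by r i j \<longrightarrow> W (X i) (X j) (t i j)"
        using a inner_anodyne_least[OF _ W] by blast
      from W have "closed_under_transfinite_composition W" by (simp add: saturated_def)
      from this[unfolded closed_under_transfinite_composition_def, rule_format, of r X t L c z] i a
      show "W (X z) L (c z)" by blast
    qed
  qed
  moreover have "closed_under_retracts (inner_anodyne :: 'u smap_class)"
    unfolding closed_under_retracts_def
  proof (intro allI impI)
    fix A B X Y :: "'u sset" and f g
    assume a: "inner_anodyne X Y g \<and> is_retract A B f X Y g"
    show "inner_anodyne A B f" unfolding inner_anodyne_def
    proof (intro allI impI)
      fix W :: "'u smap_class"
      assume W: "saturated W \<and> (\<forall>A B f. inner_horn_inclusion A B f \<longrightarrow> W A B f)"
      have "W X Y g" using a inner_anodyne_least[OF _ W] by blast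
      with a W show "W A B f" unfolding saturated_def closed_under_retracts_def by metis
    qed
  qed
  ultimately show ?thesis
    unfolding saturated_def using inner_anodyne_hom by blast
qed

end

theory Submission
  imports Defs "HOL-Library.Countable_Set"
begin

text \<open>
  Consider the category with objects \<open>0\<close>, \<open>1\<close>, \<open>2\<close> in which \<open>0\<close> and \<open>1\<close> are uniquely isomorphic
  and \<open>2\<close> has exactly one morphism to each of them and none from them. A simplex of its nerve \<open>C\<close>
  is a word in the letters \<open>0\<close>, \<open>1\<close>, \<open>2\<close> whose letters \<open>2\<close> come first. Let \<open>E\<close> consist of the words
  without \<open>2\<close>, let \<open>A\<close> be \<open>E\<close> together with the edge \<open>20\<close>, and let \<open>B\<close> be \<open>E\<close> together with the
  triangle \<open>210\<close>, so that \<open>A\<close> is contained in \<open>B\<close> and \<open>B\<close> in \<open>C\<close>.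

  Both \<open>A\<close> and \<open>B\<close> exhaust \<open>C\<close> by inner horns. For a letter \<open>l \<le> 1\<close> let \<open>z\<close> be the infinite zigzag
  \<open>2, l, 1 - l, l, 1 - l, \<dots>\<close>, and let the stage \<open>s\<close> be \<open>E\<close> together with the first \<open>s + 2\<close> letters
  of \<open>z\<close>, viewed as an \<open>(s + 1)\<close>-simplex, and all its faces and degeneracies. Passing to the next
  stage attaches one simplex of dimension \<open>s + 2\<close>. Its face opposite to the vertex \<open>0\<close> lies in \<open>E\<close>, its last
  face is the simplex of the stage before, and its face opposite to a vertex strictly between \<open>1\<close> and \<open>s + 2\<close> is
  degenerate because it repeats a letter, so that it lies in the stage before as well. The face
  opposite to the vertex \<open>1\<close> starts with \<open>2\<close> and \<open>1 - l\<close> and is new. Hence the attachment is a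
  pushout of the inner horn with missing face \<open>1\<close> (\<open>inner_anodyne_stage_Suc\<close>). The stages for \<open>l = 0\<close>
  and for \<open>l = 1\<close> interleave, since the zigzag for \<open>l\<close> is the one for \<open>1 - l\<close> with its vertex \<open>1\<close>
  omitted, so they have the same union \<open>C\<close>. As \<open>A\<close> is the stage \<open>0\<close> for \<open>l = 0\<close> and \<open>B\<close> is the stage
  \<open>1\<close> for \<open>l = 1\<close>, the inclusions of both into \<open>C\<close> are inner anodyne
  (\<open>inner_anodyne_stage_zigzag_complex\<close>).

  The inclusion of \<open>A\<close> in \<open>B\<close>, however, is an inner fibration that is not an isomorphism, so it
  cannot lift against itself. In detail, a simplex of \<open>B\<close> outside \<open>A\<close> is a word \<open>2\<dots>21\<dots>10\<dots>0\<close>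
  with at least one \<open>2\<close> and one \<open>1\<close>, and in dimension at least two its first or its last face
  still has both letters; these two faces belong to every inner horn
  (\<open>inner_horn_detects_stage_0\<close>). Therefore inner horn inclusions belong to the class of those
  maps \<open>f\<close> such that a map into \<open>B\<close> lands in \<open>A\<close> as soon as its composite with \<open>f\<close> does. This
  class is saturated (\<open>saturated_orthogonal\<close>) and does not contain the inclusion of \<open>A\<close> in \<open>B\<close>.
\<close>

section \<open>Maps of simplicial sets\<close>

lemma smap_comp_apply: "x \<in> simplices X n \<Longrightarrow> smap_comp X g f n x = g n (f n x)"
  by (simp add: smap_comp_def compose_def)

lemma smap_id_apply: "x \<in> simplices X n \<Longrightarrow> smap_id X n x = x"
  by (simp add: smap_id_def)

lemma sset_hom_mem: "f \<in> sset_hom X Y \<Longrightarrow> x \<in> simplices X n \<Longrightarrow> f n x \<in> simplices Y n"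
  by (auto simp: sset_hom_def PiE_iff)

lemma sset_hom_act:
  "f \<in> sset_hom X Y \<Longrightarrow> \<theta> \<in> Delta_hom m n \<Longrightarrow> x \<in> simplices X n \<Longrightarrow>
   f m (act X m n \<theta> x) = act Y m n \<theta> (f n x)"
  by (auto simp: sset_hom_def)

lemma simplicial_set_act:
  "simplicial_set X \<Longrightarrow> \<theta> \<in> Delta_hom m n \<Longrightarrow> x \<in> simplices X n \<Longrightarrow> act X m n \<theta> x \<in> simplices X m"
  by (auto simp: simplicial_set_def)

lemma sset_hom_simplicial_set:
  assumes "f \<in> sset_hom X Y" shows "simplicial_set X" "simplicial_set Y"
  using assms by (auto simp: sset_hom_def)

lemma sset_homI:
  assumes "simplicial_set X" "simplicial_set Y"
    and "\<And>n. f n \<in> extensional (simplices X n)"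
    and "\<And>n x. x \<in> simplices X n \<Longrightarrow> f n x \<in> simplices Y n"
    and "\<And>m n \<theta> x. \<theta> \<in> Delta_hom m n \<Longrightarrow> x \<in> simplices X n \<Longrightarrow>
           f m (act X m n \<theta> x) = act Y m n \<theta> (f n x)"
  shows "f \<in> sset_hom X Y"
  using assms by (auto simp: sset_hom_def PiE_def)

lemma smap_eqI:
  assumes f: "f \<in> sset_hom X Y" and g: "g \<in> sset_hom X Z"
    and eq: "\<And>n x. x \<in> simplices X n \<Longrightarrow> f n x = g n x"
  shows "f = g"
proof
  fix n
  have "f n \<in> extensional (simplices X n)" "g n \<in> extensional (simplices X n)"
    using f g by (auto simp: sset_hom_def PiE_def)
  then show "f n = g n" using eq by (rule extensionalityI)
qed

lemma smap_comp_hom: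
  assumes f: "f \<in> sset_hom X Y" and g: "g \<in> sset_hom Y Z"
  shows "smap_comp X g f \<in> sset_hom X Z"
proof (rule sset_homI)
  show "smap_comp X g f n \<in> extensional (simplices X n)" for n
    by (simp add: smap_comp_def)
next
  fix m n \<theta> x assume "\<theta> \<in> Delta_hom m n" "x \<in> simplices X n"
  then show "smap_comp X g f m (act X m n \<theta> x) = act Z m n \<theta> (smap_comp X g f n x)"
    using f g by (simp add: smap_comp_apply simplicial_set_act[OF sset_hom_simplicial_set(1)[OF f]]
        sset_hom_act[OF f] sset_hom_act[OF g] sset_hom_mem[OF f])
qed (use f g in \<open>auto simp: smap_comp_apply intro: sset_hom_mem dest: sset_hom_simplicial_set\<close>)

lemma smap_comp_assoc:
  assumes "f \<in> sset_hom X Y"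
  shows "smap_comp X (smap_comp Y h g) f = smap_comp X h (smap_comp X g f)"
  using sset_hom_mem[OF assms]
  by (auto simp: smap_comp_def compose_def fun_eq_iff)

lemma smap_id_comp: "f \<in> sset_hom X Y \<Longrightarrow> smap_comp X (smap_id Y) f = f"
  by (auto simp: fun_eq_iff sset_hom_def smap_comp_def smap_id_def compose_def PiE_iff extensional_def)

lemma smap_comp_id: "f \<in> sset_hom X Y \<Longrightarrow> smap_comp X f (smap_id X) = f"
  by (auto simp: fun_eq_iff sset_hom_def smap_comp_def smap_id_def compose_def PiE_iff extensional_def)

section \<open>Subcomplexes\<close>

definition subcomplex :: "'a sset \<Rightarrow> 'a sset \<Rightarrow> bool" where
  "subcomplex X Y \<longleftrightarrow> smap_id X \<in> sset_hom X Y"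

lemma subcomplex_iff:
  "subcomplex X Y \<longleftrightarrow> simplicial_set X \<and> simplicial_set Y \<and>
     (\<forall>n. simplices X n \<subseteq> simplices Y n) \<and>
     (\<forall>m n. \<forall>\<theta>\<in>Delta_hom m n. \<forall>x\<in>simplices X n. act X m n \<theta> x = act Y m n \<theta> x)"
  unfolding subcomplex_def sset_hom_def
  by (auto simp: smap_id_def simplicial_set_act PiE_iff)

lemma subcomplex_refl: "simplicial_set X \<Longrightarrow> subcomplex X X"
  by (simp add: subcomplex_iff)

lemma subcomplex_trans: "subcomplex X Y \<Longrightarrow> subcomplex Y Z \<Longrightarrow> subcomplex X Z"
  unfolding subcomplex_iff by (simp add: subset_iff)

lemma smap_comp_inclusions:
  assumes "subcomplex X Y" shows "smap_comp X (smap_id Y) (smap_id X) = smap_id X"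
  by (rule smap_id_comp) (use assms in \<open>simp add: subcomplex_def\<close>)

text \<open>
  Because maps are extensional on their domain, a map into a subcomplex and its composite with the
  inclusion are the same function.
\<close>

lemma sset_hom_subcomplex_iff:
  assumes "subcomplex S T"
  shows "f \<in> sset_hom X S \<longleftrightarrow>
    f \<in> sset_hom X T \<and> (\<forall>n. \<forall>x\<in>simplices X n. f n x \<in> simplices S n)"
proof -
  have ss: "simplicial_set S" "simplicial_set T"
    and sub: "\<And>n x. x \<in> simplices S n \<Longrightarrow> x \<in> simplices T n"
    and eq: "\<And>m n \<theta> x. \<theta> \<in> Delta_hom m n \<Longrightarrow> x \<in> simplices S n \<Longrightarrow> act S m n \<theta> x = act T m n \<theta> x"
    using assms by (auto simp: subcomplex_iff)
  show ?thesis
  proof (intro iffI conjI allI ballI)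
    assume f: "f \<in> sset_hom X S"
    show "f \<in> sset_hom X T"
    proof (rule sset_homI)
      show "f n \<in> extensional (simplices X n)" for n using f by (auto simp: sset_hom_def PiE_iff)
    qed (use f ss sub eq in \<open>auto simp: sset_hom_act sset_hom_mem dest: sset_hom_simplicial_set\<close>)
    show "f n x \<in> simplices S n" if "x \<in> simplices X n" for n x
      using f that by (rule sset_hom_mem)
  next
    assume f: "f \<in> sset_hom X T \<and> (\<forall>n. \<forall>x\<in>simplices X n. f n x \<in> simplices S n)"
    show "f \<in> sset_hom X S"
    proof (rule sset_homI)
      show "f n \<in> extensional (simplices X n)" for n using f by (auto simp: sset_hom_def PiE_iff)
    qed (use f ss eq in \<open>auto simp: sset_hom_act dest: sset_hom_simplicial_set\<close>)
  qed
qed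

lemma sset_mono_inclusion:
  assumes "subcomplex X Y" shows "sset_mono X Y (smap_id X)"
  unfolding sset_mono_def
proof (intro conjI allI ballI impI)
  show "smap_id X \<in> sset_hom X Y" using assms by (simp add: subcomplex_def)
  fix Z g h assume "g \<in> sset_hom Z X" "h \<in> sset_hom Z X"
    "smap_comp Z (smap_id X) g = smap_comp Z (smap_id X) h"
  then show "g = h" by (simp add: smap_id_comp)
qed

text \<open>
  A square of inclusions and a map that is a bijection between the added simplices is a pushout:
  a map out of \<open>D\<close> is prescribed on \<open>C\<close> by one leg of a cocone and off \<open>C\<close> by the other, and the
  two prescriptions fit together along the simplices that \<open>v\<close> carries into \<open>C\<close>, which are exactly
  those of \<open>A\<close>.
\<close>

lemma pushout_of_relative_bijection:
  fixes A B C D :: "'u sset"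
  assumes AB: "subcomplex A B" and CD: "subcomplex C D" and v: "v \<in> sset_hom B D"
    and cover: "\<And>m. simplices D m \<subseteq> simplices C m \<union> v m ` simplices B m"
    and pre: "\<And>m x. x \<in> simplices B m \<Longrightarrow> v m x \<in> simplices C m \<longleftrightarrow> x \<in> simplices A m"
    and inj: "\<And>m. inj_on (v m) (simplices B m - simplices A m)"
  shows "is_pushout A B C D (smap_id A) (smap_comp A v (smap_id A)) v (smap_id C)"
proof -
  have idA: "smap_id A \<in> sset_hom A B" and idC: "smap_id C \<in> sset_hom C D"
    using AB CD by (auto simp: subcomplex_def)
  have ssB: "simplicial_set B" and ssD: "simplicial_set D" and ssC: "simplicial_set C"
    using AB CD by (auto simp: subcomplex_iff)
  have subAB: "x \<in> simplices A n \<Longrightarrow> x \<in> simplices B n" for x n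
    using AB by (auto simp: subcomplex_iff)
  have subCD: "x \<in> simplices C n \<Longrightarrow> x \<in> simplices D n" for x n
    using CD by (auto simp: subcomplex_iff)
  have u: "smap_comp A v (smap_id A) \<in> sset_hom A C"
    unfolding sset_hom_subcomplex_iff[OF CD]
    using smap_comp_hom[OF idA v] pre subAB by (auto simp: smap_comp_apply smap_id_apply)
  show ?thesis
    unfolding is_pushout_def
  proof (intro conjI allI ballI impI)
    show "smap_comp A v (smap_id A) = smap_comp A (smap_id C) (smap_comp A v (smap_id A))"
      using smap_id_comp[OF u] by simp
  next
    fix Z :: "'u sset" and p q
    assume p: "p \<in> sset_hom B Z" and q: "q \<in> sset_hom C Z"
      and sq: "smap_comp A p (smap_id A) = smap_comp A q (smap_comp A v (smap_id A))"
    have agree: "p n x = q n (v n x)" if "x \<in> simplices A n" for n x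
      using fun_cong[OF fun_cong[OF sq, of n], of x] that by (simp add: smap_comp_apply smap_id_apply)
    define h where "h = (\<lambda>n. \<lambda>y\<in>simplices D n. if y \<in> simplices C n then q n y
        else p n (inv_into (simplices B n - simplices A n) (v n) y))"
    have hC: "h n y = q n y" if "y \<in> simplices C n" for n y
      using that subCD by (simp add: h_def)
    have hv: "h n (v n x) = p n x" if x: "x \<in> simplices B n" for n x
    proof (cases "x \<in> simplices A n")
      case True
      then show ?thesis using hC pre[OF x] agree by simp
    next
      case False
      then have "v n x \<notin> simplices C n" "v n x \<in> simplices D n"
        using pre[OF x] sset_hom_mem[OF v x] by auto
      then show ?thesis using False x by (simp add: h_def inv_into_f_f[OF inj])
    qed
    have D_cases: "y \<in> simplices C n \<or> (\<exists>x\<in>simplices B n. y = v n x)" if "y \<in> simplices D n" for n y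
      using cover that by blast
    have h: "h \<in> sset_hom D Z"
    proof (rule sset_homI)
      show "h n \<in> extensional (simplices D n)" for n by (simp add: h_def)
      show "h n y \<in> simplices Z n" if "y \<in> simplices D n" for n y
        using D_cases[OF that] hC hv sset_hom_mem[OF p] sset_hom_mem[OF q] by auto
      fix m n \<theta> y assume \<theta>: "\<theta> \<in> Delta_hom m n" and y: "y \<in> simplices D n"
      from D_cases[OF y] show "h m (act D m n \<theta> y) = act Z m n \<theta> (h n y)"
      proof (elim disjE bexE)
        assume yC: "y \<in> simplices C n"
        then have "act D m n \<theta> y = act C m n \<theta> y" using CD \<theta> by (auto simp: subcomplex_iff)
        then show ?thesis
          using yC hC simplicial_set_act[OF ssC \<theta> yC] sset_hom_act[OF q \<theta> yC] by simp
      next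
        fix x assume x: "x \<in> simplices B n" and "y = v n x"
        then show ?thesis
          using hv simplicial_set_act[OF ssB \<theta> x] sset_hom_act[OF v \<theta> x] sset_hom_act[OF p \<theta> x]
          by metis
      qed
    qed (use ssD p in \<open>auto dest: sset_hom_simplicial_set\<close>)
    show "\<exists>!h. h \<in> sset_hom D Z \<and> smap_comp B h v = p \<and> smap_comp C h (smap_id C) = q"
    proof (rule ex1I[of _ h])
      have "smap_comp B h v = p"
        using hv by (intro smap_eqI[OF smap_comp_hom[OF v h] p]) (simp add: smap_comp_apply)
      moreover have "smap_comp C h (smap_id C) = q"
        using hC by (intro smap_eqI[OF smap_comp_hom[OF idC h] q])
          (simp add: smap_comp_apply smap_id_apply)
      ultimately show "h \<in> sset_hom D Z \<and> smap_comp B h v = p \<and> smap_comp C h (smap_id C) = q"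
        using h by simp
    next
      fix h' assume h': "h' \<in> sset_hom D Z \<and> smap_comp B h' v = p \<and> smap_comp C h' (smap_id C) = q"
      show "h' = h"
      proof (rule smap_eqI[where X = D])
        fix n y assume "y \<in> simplices D n"
        from D_cases[OF this] show "h' n y = h n y"
        proof (elim disjE bexE)
          assume y: "y \<in> simplices C n"
          have "h' n y = smap_comp C h' (smap_id C) n y"
            using y by (simp add: smap_comp_apply smap_id_apply)
          then show ?thesis using h' hC y by simp
        next
          fix x assume x: "x \<in> simplices B n" and "y = v n x"
          moreover have "h' n (v n x) = smap_comp B h' v n x" using x by (simp add: smap_comp_apply)
          ultimately show ?thesis using h' hv by simp
        qed
      qed (use h h' in auto)
    qed
  qed (use idA idC u v in auto)
qed

section \<open>Countable filtrations\<close>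

lemma natLeq_image_iff: "inj a \<Longrightarrow> (a i, a j) \<in> dir_image natLeq a \<longleftrightarrow> i \<le> j"
  by (auto simp: dir_image_def natLeq_def inj_eq)

text \<open>
  The injection \<open>a\<close> re-indexes the filtration by the universe type, since the ordinals of
  \<open>closed_under_transfinite_composition\<close> are well-orders on that type.
\<close>

lemma filtration_is_colimit:
  fixes X :: "nat \<Rightarrow> 'u sset" and a :: "nat \<Rightarrow> 'i"
  assumes a: "inj a" and sub: "\<And>i. subcomplex (X i) L"
    and incr: "\<And>i j. i \<le> j \<Longrightarrow> subcomplex (X i) (X j)"
    and cover: "\<And>n. simplices L n \<subseteq> (\<Union>i. simplices (X i) n)"
  shows "is_colimit (range a) (dir_image natLeq a) (\<lambda>u. X (inv a u))
    (\<lambda>u _. smap_id (X (inv a u))) L (\<lambda>u. smap_id (X (inv a u)))"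
  unfolding is_colimit_def
proof (intro conjI allI ballI impI)
  show "simplicial_set L" using sub[of 0] by (auto simp: subcomplex_iff)
  show "smap_id (X (inv a u)) \<in> sset_hom (X (inv a u)) L" for u
    using sub by (auto simp: subcomplex_def)
  fix u w assume uw: "(u, w) \<in> dir_image natLeq a"
  have "subcomplex (X (inv a u)) (X (inv a w))"
    using uw a incr by (auto simp: dir_image_def natLeq_def inv_f_f)
  then show "smap_comp (X (inv a u)) (smap_id (X (inv a w))) (smap_id (X (inv a u)))
      = smap_id (X (inv a u))"
    by (rule smap_comp_inclusions)
next
  fix Z :: "'u sset" and p
  assume "simplicial_set Z \<and> (\<forall>i\<in>range a. p i \<in> sset_hom (X (inv a i)) Z) \<and>
      (\<forall>i\<in>range a. \<forall>j\<in>range a. (i, j) \<in> dir_image natLeq a \<longrightarrow>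
        smap_comp (X (inv a i)) (p j) (smap_id (X (inv a i))) = p i)"
  then have Z: "simplicial_set Z" and p: "p (a i) \<in> sset_hom (X i) Z"
    and compat: "i \<le> j \<Longrightarrow> smap_comp (X i) (p (a j)) (smap_id (X i)) = p (a i)" for i j
    by (auto simp: natLeq_image_iff[OF a] inv_f_f[OF a])
  have mono: "p (a j) n x = p (a i) n x" if "i \<le> j" "x \<in> simplices (X i) n" for i j n x
    using fun_cong[OF fun_cong[OF compat[OF that(1)], of n], of x] that(2)
    by (simp add: smap_comp_apply smap_id_apply)
  have same: "p (a j) n x = p (a i) n x"
    if "x \<in> simplices (X i) n" "x \<in> simplices (X j) n" for i j n x
    using mono[of i j] mono[of j i] that by (metis nat_le_linear)
  define h where "h = (\<lambda>n. \<lambda>x\<in>simplices L n. p (a (SOME i. x \<in> simplices (X i) n)) n x)"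
  have subL: "x \<in> simplices L n" if "x \<in> simplices (X i) n" for x i n
    using sub that by (auto simp: subcomplex_iff)
  have hX: "h n x = p (a i) n x" if x: "x \<in> simplices (X i) n" for n x i
  proof -
    have "x \<in> simplices (X (SOME i. x \<in> simplices (X i) n)) n"
      using x by (rule someI)
    from same[OF x this] show ?thesis using subL[OF x] by (simp add: h_def)
  qed
  have L_cases: "\<exists>i. x \<in> simplices (X i) n" if "x \<in> simplices L n" for x n
    using cover that by blast
  have h: "h \<in> sset_hom L Z"
  proof (rule sset_homI)
    show "h n \<in> extensional (simplices L n)" for n by (simp add: h_def)
    show "h n y \<in> simplices Z n" if "y \<in> simplices L n" for n y
      using L_cases[OF that] hX sset_hom_mem[OF p] by auto
    fix m n \<theta> x assume \<theta>: "\<theta> \<in> Delta_hom m n" and "x \<in> simplices L n"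
    then obtain i where x: "x \<in> simplices (X i) n" using L_cases by blast
    have "simplicial_set (X i)" and act: "act L m n \<theta> x = act (X i) m n \<theta> x"
      using sub[of i] \<theta> x by (auto simp: subcomplex_iff)
    moreover from this have "act (X i) m n \<theta> x \<in> simplices (X i) m"
      using \<theta> x by (intro simplicial_set_act)
    ultimately show "h m (act L m n \<theta> x) = act Z m n \<theta> (h n x)"
      using hX x sset_hom_act[OF p \<theta> x] by simp
  qed (use sub[of 0] Z in \<open>auto simp: subcomplex_iff\<close>)
  show "\<exists>!h. h \<in> sset_hom L Z \<and>
      (\<forall>i\<in>range a. smap_comp (X (inv a i)) h (smap_id (X (inv a i))) = p i)"
  proof (rule ex1I[of _ h])
    have "smap_comp (X i) h (smap_id (X i)) = p (a i)" for i
      using sub[of i] hX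
      by (intro smap_eqI[OF smap_comp_hom[OF _ h] p])
        (auto simp: subcomplex_def smap_comp_apply smap_id_apply)
    then show "h \<in> sset_hom L Z \<and>
        (\<forall>i\<in>range a. smap_comp (X (inv a i)) h (smap_id (X (inv a i))) = p i)"
      using h a by auto
  next
    fix h' assume h': "h' \<in> sset_hom L Z \<and>
        (\<forall>i\<in>range a. smap_comp (X (inv a i)) h' (smap_id (X (inv a i))) = p i)"
    have h'X: "smap_comp (X i) h' (smap_id (X i)) = p (a i)" for i
      using h' a by (metis inv_f_f rangeI)
    show "h' = h"
    proof (rule smap_eqI[where X = L])
      fix n x assume "x \<in> simplices L n"
      then obtain i where x: "x \<in> simplices (X i) n" using L_cases by blast
      then have "h' n x = smap_comp (X i) h' (smap_id (X i)) n x"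
        by (simp add: smap_comp_apply smap_id_apply)
      then show "h' n x = h n x" using hX x h'X by simp
    qed (use h h' in auto)
  qed
qed

lemma covered_by_natLeq_image:
  assumes a: "inj a" and "covered_by (dir_image natLeq a) u w"
  shows "\<exists>i. u = a i \<and> w = a (Suc i)"
proof -
  have uw: "(u, w) \<in> dir_image natLeq a" "u \<noteq> w"
    and no: "\<And>v. (u, v) \<in> dir_image natLeq a \<Longrightarrow> (v, w) \<in> dir_image natLeq a \<Longrightarrow> v = u \<or> v = w"
    using assms(2) by (auto simp: covered_by_def)
  then obtain i j where ij: "u = a i" "w = a j" "i \<le> j" "i \<noteq> j"
    by (auto simp: dir_image_def natLeq_def)
  have "a (Suc i) = u \<or> a (Suc i) = w"
    using ij by (intro no) (auto simp: natLeq_image_iff[OF a])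
  then have "j = Suc i" using a ij by (auto simp: inj_eq)
  then show ?thesis using ij by blast
qed

text \<open>
  A filtration indexed by the natural numbers is a transfinite sequence without limit indices, so
  continuity is vacuous and only the successor steps matter.
\<close>

lemma inner_anodyne_filtration:
  fixes X :: "nat \<Rightarrow> 'u sset"
  assumes inf: "infinite (UNIV :: 'u set)" and sub: "\<And>i. subcomplex (X i) L"
    and step: "\<And>i. inner_anodyne (X i) (X (Suc i)) (smap_id (X i))"
    and cover: "\<And>n. simplices L n \<subseteq> (\<Union>i. simplices (X i) n)"
  shows "inner_anodyne (X 0) L (smap_id (X 0))"
proof -
  obtain a :: "nat \<Rightarrow> 'u" where a: "inj a"
    using infinite_countable_subset[OF inf] by blast
  define r where "r = dir_image natLeq a"
  define Y where "Y = (\<lambda>u. X (inv a u))"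
  have sub_Suc: "subcomplex (X i) (X (Suc i))" for i
    using inner_anodyne_hom[OF step] by (simp add: subcomplex_def)
  have incr: "subcomplex (X i) (X j)" if "i \<le> j" for i j
    using that
  proof (induction j rule: dec_induct)
    case base
    show ?case using sub[of i] by (intro subcomplex_refl) (simp add: subcomplex_iff)
  next
    case (step j)
    show ?case using step.IH sub_Suc by (rule subcomplex_trans)
  qed
  have r_refl: "(a i, a i) \<in> r" for i by (simp add: r_def natLeq_image_iff[OF a])
  have r_iff: "(u, w) \<in> r \<longleftrightarrow> (\<exists>i j. u = a i \<and> w = a j \<and> i \<le> j)" for u w
    by (auto simp: r_def dir_image_def natLeq_def)
  have Field: "Field r = range a"
  proof
    show "Field r \<subseteq> range a" by (auto simp: Field_def r_iff)
    show "range a \<subseteq> Field r"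
      using FieldI1[OF r_refl] by blast
  qed
  have Ya: "Y (a i) = X i" for i using a by (simp add: Y_def)
  have wo: "Well_order r" unfolding r_def
    using natLeq_Well_order a by (intro Well_order_dir_image) (auto intro: inj_on_subset)
  have bottom: "is_bottom r (a 0)" by (auto simp: is_bottom_def Field r_iff)
  have no_limit: "\<not> is_limit r u" for u
  proof
    assume u: "is_limit r u"
    then obtain i where i: "u = a i" by (auto simp: is_limit_def Field)
    then obtain j where "i = Suc j" using u bottom by (cases i) (auto simp: is_limit_def)
    then have "covered_by r (a j) u" using i a
      by (auto simp: covered_by_def r_iff inj_eq dest: injD[OF a])
    then show False using u by (auto simp: is_limit_def)
  qed
  have "transfinite_sequence r Y (\<lambda>u _. smap_id (Y u))"
    unfolding transfinite_sequence_def using wo incr no_limit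
    by (auto simp: r_iff Ya subcomplex_def[symmetric] smap_comp_inclusions)
  moreover have "\<forall>u w. covered_by r u w \<longrightarrow> inner_anodyne (Y u) (Y w) (smap_id (Y u))"
    using covered_by_natLeq_image[OF a] step by (fastforce simp: r_def Ya)
  moreover have "is_colimit (Field r) r Y (\<lambda>u _. smap_id (Y u)) L (\<lambda>u. smap_id (Y u))"
    unfolding Field unfolding Y_def r_def by (rule filtration_is_colimit[OF a sub incr cover])
  ultimately have "inner_anodyne (Y (a 0)) L (smap_id (Y (a 0)))"
    using saturated_inner_anodyne[where 'u = 'u] bottom
    unfolding saturated_def closed_under_transfinite_composition_def by blast
  then show ?thesis by (simp add: Ya)
qed

section \<open>Orthogonality to an inclusion\<close>

text \<open>
  For an inclusion of a subcomplex, lifts are unique if they exist, and a lift of \<open>g\<close> is \<open>g\<close> itself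
  with a smaller codomain. The left lifting property against the inclusion of \<open>S\<close> in \<open>T\<close> thus takes
  this form, in which no lift has to be chosen.
\<close>

definition orthogonal :: "'u sset \<Rightarrow> 'u sset \<Rightarrow> 'u smap_class" where
  "orthogonal S T X Y f \<longleftrightarrow> f \<in> sset_hom X Y \<and>
     (\<forall>g\<in>sset_hom Y T. smap_comp X g f \<in> sset_hom X S \<longrightarrow> g \<in> sset_hom Y S)"

text \<open>
  The maps \<open>g \<circ> c i\<close> form a cocone with vertex \<open>S\<close> as well as one with vertex \<open>T\<close>; the map that they induce into \<open>S\<close>
  agrees with \<open>g\<close> by uniqueness of induced maps into \<open>T\<close>.
\<close>

lemma colimit_hom_subcomplex:
  fixes S T L :: "'u sset"
  assumes ST: "subcomplex S T" and col: "is_colimit I r X t L c" and g: "g \<in> sset_hom L T"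
    and gc: "\<And>i. i \<in> I \<Longrightarrow> smap_comp (X i) g (c i) \<in> sset_hom (X i) S"
    and t: "\<And>i j. i \<in> I \<Longrightarrow> j \<in> I \<Longrightarrow> (i, j) \<in> r \<Longrightarrow> t i j \<in> sset_hom (X i) (X j)"
  shows "g \<in> sset_hom L S"
proof -
  let ?p = "\<lambda>i. smap_comp (X i) g (c i)"
  have ST': "f \<in> sset_hom Z S \<Longrightarrow> f \<in> sset_hom Z T" for Z and f
    by (simp add: sset_hom_subcomplex_iff[OF ST])
  have compat: "smap_comp (X i) (?p j) (t i j) = ?p i" if "i \<in> I" "j \<in> I" "(i, j) \<in> r" for i j
  proof -
    have "smap_comp (X i) (c j) (t i j) = c i" using that col by (auto simp: is_colimit_def)
    then show ?thesis by (simp add: smap_comp_assoc[OF t[OF that]])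
  qed
  have univ: "\<exists>!h. h \<in> sset_hom L Z \<and> (\<forall>i\<in>I. smap_comp (X i) h (c i) = ?p i)"
    if "simplicial_set Z" "\<And>i. i \<in> I \<Longrightarrow> ?p i \<in> sset_hom (X i) Z" for Z :: "'u sset"
    using col[unfolded is_colimit_def, THEN conjunct2, THEN conjunct2, THEN conjunct2,
        THEN spec[of _ Z], THEN spec[of _ ?p]] that compat by blast
  have "\<exists>!h. h \<in> sset_hom L S \<and> (\<forall>i\<in>I. smap_comp (X i) h (c i) = ?p i)"
    using ST gc by (intro univ) (auto simp: subcomplex_iff)
  then obtain h where h: "h \<in> sset_hom L S" "\<forall>i\<in>I. smap_comp (X i) h (c i) = ?p i" by blast
  have "\<exists>!h. h \<in> sset_hom L T \<and> (\<forall>i\<in>I. smap_comp (X i) h (c i) = ?p i)"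
    using ST gc ST' by (intro univ) (auto simp: subcomplex_iff)
  then have "h = g" using h ST' g by blast
  then show ?thesis using h by simp
qed

lemma coproduct_is_colimit:
  "is_coproduct I X S c \<Longrightarrow> is_colimit I {} X t S c"
  by (simp add: is_coproduct_def is_colimit_def)

lemma orthogonal_pushout:
  fixes S T :: "'u sset"
  assumes ST: "subcomplex S T" and f: "orthogonal S T A B f" and po: "is_pushout A B C D f u v g"
  shows "orthogonal S T C D g"
  unfolding orthogonal_def
proof (intro conjI ballI impI)
  have fm: "f \<in> sset_hom A B" and u: "u \<in> sset_hom A C" and v: "v \<in> sset_hom B D"
    and g: "g \<in> sset_hom C D" and sq: "smap_comp A v f = smap_comp A g u"
    using po by (auto simp: is_pushout_def)
  show "g \<in> sset_hom C D" by fact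
  fix k assume k: "k \<in> sset_hom D T" and kg: "smap_comp C k g \<in> sset_hom C S"
  have ST': "f \<in> sset_hom Z S \<Longrightarrow> f \<in> sset_hom Z T" for Z and f
    by (simp add: sset_hom_subcomplex_iff[OF ST])
  have eq: "smap_comp A (smap_comp B k v) f = smap_comp A (smap_comp C k g) u"
    by (simp add: smap_comp_assoc[OF fm] smap_comp_assoc[OF u] sq)
  have "smap_comp B k v \<in> sset_hom B T" using v k by (rule smap_comp_hom)
  moreover have "smap_comp A (smap_comp B k v) f \<in> sset_hom A S"
    unfolding eq using u kg by (rule smap_comp_hom)
  ultimately have kv: "smap_comp B k v \<in> sset_hom B S"
    using f by (auto simp: orthogonal_def)
  have univ: "\<exists>!h. h \<in> sset_hom D Z \<and> smap_comp B h v = smap_comp B k v \<and>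
      smap_comp C h g = smap_comp C k g"
    if "smap_comp B k v \<in> sset_hom B Z" "smap_comp C k g \<in> sset_hom C Z" for Z :: "'u sset"
    using po that eq unfolding is_pushout_def by blast
  obtain h where h: "h \<in> sset_hom D S" "smap_comp B h v = smap_comp B k v"
    "smap_comp C h g = smap_comp C k g"
    using univ[OF kv kg] by blast
  have "h = k" using univ[OF ST'[OF kv] ST'[OF kg]] h ST' k by blast
  then show "k \<in> sset_hom D S" using h by simp
qed

lemma orthogonal_coproduct:
  assumes ST: "subcomplex S T" and f: "\<And>i. i \<in> I \<Longrightarrow> orthogonal S T (A i) (B i) (f i)"
    and a: "is_coproduct I A SA a" and b: "is_coproduct I B SB b" and h: "h \<in> sset_hom SA SB"
    and sq: "\<And>i. i \<in> I \<Longrightarrow> smap_comp (A i) h (a i) = smap_comp (A i) (b i) (f i)"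
  shows "orthogonal S T SA SB h"
  unfolding orthogonal_def
proof (intro conjI ballI impI)
  show "h \<in> sset_hom SA SB" by fact
  fix k assume k: "k \<in> sset_hom SB T" and kh: "smap_comp SA k h \<in> sset_hom SA S"
  show "k \<in> sset_hom SB S"
  proof (rule colimit_hom_subcomplex[OF ST coproduct_is_colimit[OF b] k])
    fix i assume i: "i \<in> I"
    have fi: "f i \<in> sset_hom (A i) (B i)" and ai: "a i \<in> sset_hom (A i) SA"
      and bi: "b i \<in> sset_hom (B i) SB"
      using i f a b by (auto simp: orthogonal_def is_coproduct_def)
    have "smap_comp (A i) (smap_comp (B i) k (b i)) (f i)
        = smap_comp (A i) (smap_comp SA k h) (a i)"
      by (simp add: smap_comp_assoc[OF fi] smap_comp_assoc[OF ai] sq[OF i])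
    moreover have "smap_comp (A i) (smap_comp SA k h) (a i) \<in> sset_hom (A i) S"
      using ai kh by (rule smap_comp_hom)
    ultimately show "smap_comp (B i) k (b i) \<in> sset_hom (B i) S"
      using f[OF i] smap_comp_hom[OF bi k] by (auto simp: orthogonal_def)
  qed auto
qed

text \<open>
  Well-founded induction along the ordinal shows that every \<open>X k\<close> is carried into \<open>S\<close>: by hypothesis
  at the bottom, by orthogonality at a successor, and by \<open>colimit_hom_subcomplex\<close> at a limit. The
  same lemma then passes to the colimit \<open>L\<close>.
\<close>

lemma orthogonal_transfinite_composition:
  assumes ST: "subcomplex S T" and seq: "transfinite_sequence r X t"
    and succ: "\<And>i j. covered_by r i j \<Longrightarrow> orthogonal S T (X i) (X j) (t i j)"
    and col: "is_colimit (Field r) r X t L c" and z: "is_bottom r z"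
  shows "orthogonal S T (X z) L (c z)"
  unfolding orthogonal_def
proof (intro conjI ballI impI)
  have wo: "Well_order r" and tm: "(i, j) \<in> r \<Longrightarrow> t i j \<in> sset_hom (X i) (X j)"
    and lim: "is_limit r k \<Longrightarrow> is_colimit (underS r k) r X t (X k) (\<lambda>i. t i k)" for i j k
    using seq by (auto simp: transfinite_sequence_def)
  have cm: "i \<in> Field r \<Longrightarrow> c i \<in> sset_hom (X i) L" 
    and ct: "(i, j) \<in> r \<Longrightarrow> smap_comp (X i) (c j) (t i j) = c i" for i j
    using col by (auto simp: is_colimit_def FieldI1 FieldI2)
  show "c z \<in> sset_hom (X z) L" using cm z by (auto simp: is_bottom_def)
  fix g assume g: "g \<in> sset_hom L T" and gz: "smap_comp (X z) g (c z) \<in> sset_hom (X z) S"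
  have restrict: "smap_comp (X i) (smap_comp (X k) g (c k)) (t i k) = smap_comp (X i) g (c i)"
    if "(i, k) \<in> r" for i k
    by (simp add: smap_comp_assoc[OF tm[OF that]] ct[OF that])
  have gc: "smap_comp (X k) g (c k) \<in> sset_hom (X k) T" if "k \<in> Field r" for k
    using cm[OF that] g by (rule smap_comp_hom)
  have all: "k \<in> Field r \<longrightarrow> smap_comp (X k) g (c k) \<in> sset_hom (X k) S" for k
  proof (induction k rule: wf_induct_rule[OF wo_rel.WF[unfolded wo_rel_def, OF wo]])
    fix k assume "\<And>i. (i, k) \<in> r - Id \<Longrightarrow>
      i \<in> Field r \<longrightarrow> smap_comp (X i) g (c i) \<in> sset_hom (X i) S"
    then have IH: "smap_comp (X i) g (c i) \<in> sset_hom (X i) S" if "(i, k) \<in> r" "i \<noteq> k" for i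
      using that by (auto simp: FieldI1)
    show "k \<in> Field r \<longrightarrow> smap_comp (X k) g (c k) \<in> sset_hom (X k) S"
    proof
      assume k: "k \<in> Field r"
      consider "is_bottom r k" | i where "covered_by r i k" | "is_limit r k"
        using k by (auto simp: is_limit_def)
      then show "smap_comp (X k) g (c k) \<in> sset_hom (X k) S"
      proof cases
        case 1
        then have "k = z" using z wo
          by (auto simp: is_bottom_def order_on_defs antisym_def)
        then show ?thesis using gz by simp
      next
        case 2
        then have ik: "(i, k) \<in> r" "i \<noteq> k" by (auto simp: covered_by_def)
        then show ?thesis
          using succ[OF 2] IH[OF ik] gc[OF k] restrict[OF ik(1)] by (auto simp: orthogonal_def)
      next
        case 3
        show ?thesis
          by (rule colimit_hom_subcomplex[OF ST lim[OF 3] gc[OF k]])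
            (use IH restrict tm in \<open>auto simp: underS_def\<close>)
      qed
    qed
  qed
  show "g \<in> sset_hom L S"
    by (rule colimit_hom_subcomplex[OF ST col g]) (use all tm in auto)
qed

lemma orthogonal_retract:
  assumes "orthogonal S T X Y g" and "is_retract A B f X Y g"
  shows "orthogonal S T A B f"
  unfolding orthogonal_def
proof (intro conjI ballI impI)
  from assms(2) obtain a p b q where
    f: "f \<in> sset_hom A B" and g: "g \<in> sset_hom X Y" and p: "p \<in> sset_hom X A"
    and b: "b \<in> sset_hom B Y" and q: "q \<in> sset_hom Y B"
    and qb: "smap_comp B q b = smap_id B" and sq: "smap_comp X f p = smap_comp X q g"
    by (auto simp: is_retract_def)
  show "f \<in> sset_hom A B" by fact
  fix k assume k: "k \<in> sset_hom B T" and kf: "smap_comp A k f \<in> sset_hom A S"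
  have "smap_comp X (smap_comp Y k q) g = smap_comp X (smap_comp A k f) p"
    by (simp add: smap_comp_assoc[OF g] smap_comp_assoc[OF p] sq)
  then have "smap_comp Y k q \<in> sset_hom Y S"
    using assms(1) smap_comp_hom[OF q k] smap_comp_hom[OF p kf] by (auto simp: orthogonal_def)
  from smap_comp_hom[OF b this] show "k \<in> sset_hom B S"
    by (simp add: smap_comp_assoc[OF b] qb smap_comp_id[OF k])
qed

lemma saturated_orthogonal:
  fixes S T :: "'u sset"
  assumes ST: "subcomplex S T" shows "saturated (orthogonal S T)"
  unfolding saturated_def
proof (intro conjI)
  show "\<forall>A B f. orthogonal S T A B f \<longrightarrow> f \<in> sset_hom A B" by (simp add: orthogonal_def)
  show "closed_under_pushouts (orthogonal S T)"
    unfolding closed_under_pushouts_def using orthogonal_pushout[OF ST] by blast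
  show "closed_under_coproducts (orthogonal S T)"
    unfolding closed_under_coproducts_def
  proof (intro allI impI)
    fix I :: "'u set" and A B f and SA SB :: "'u sset" and a b h
    assume "(\<forall>i\<in>I. orthogonal S T (A i) (B i) (f i)) \<and> is_coproduct I A SA a \<and>
      is_coproduct I B SB b \<and> h \<in> sset_hom SA SB \<and>
      (\<forall>i\<in>I. smap_comp (A i) h (a i) = smap_comp (A i) (b i) (f i))"
    then have f: "\<And>i. i \<in> I \<Longrightarrow> orthogonal S T (A i) (B i) (f i)"
      and ab: "is_coproduct I A SA a" "is_coproduct I B SB b" "h \<in> sset_hom SA SB"
      and sq: "\<And>i. i \<in> I \<Longrightarrow> smap_comp (A i) h (a i) = smap_comp (A i) (b i) (f i)"
      by blast+
    from ST f ab sq show "orthogonal S T SA SB h" by (rule orthogonal_coproduct)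
  qed
  show "closed_under_transfinite_composition (orthogonal S T)"
    unfolding closed_under_transfinite_composition_def
  proof (intro allI impI)
    fix r :: "'u rel" and X t and L :: "'u sset" and c z
    assume "transfinite_sequence r X t \<and>
      (\<forall>i j. covered_by r i j \<longrightarrow> orthogonal S T (X i) (X j) (t i j)) \<and>
      is_colimit (Field r) r X t L c \<and> is_bottom r z"
    then have seq: "transfinite_sequence r X t"
      and succ: "\<And>i j. covered_by r i j \<Longrightarrow> orthogonal S T (X i) (X j) (t i j)"
      and col: "is_colimit (Field r) r X t L c" "is_bottom r z"
      by blast+
    from ST seq succ col show "orthogonal S T (X z) L (c z)"
      by (rule orthogonal_transfinite_composition)
  qed
  show "closed_under_retracts (orthogonal S T)"
    unfolding closed_under_retracts_def using orthogonal_retract by blast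
qed

section \<open>Complexes of words\<close>

text \<open>
  A simplex is represented by the sequence of its vertices, and simplicial operators act by
  re-indexing. Standard simplices, horns and the complexes of the counterexample all have this form,
  and since there are only countably many words, all of them can be coded in any infinite type.
\<close>

definition words :: "(nat \<Rightarrow> nat) set" where
  "words = (\<Union>n. {..n} \<rightarrow>\<^sub>E UNIV)"

definition word_complex :: "(nat \<Rightarrow> (nat \<Rightarrow> nat) set) \<Rightarrow> bool" where
  "word_complex S \<longleftrightarrow> (\<forall>n. S n \<subseteq> {..n} \<rightarrow>\<^sub>E UNIV) \<and>
     (\<forall>m n. \<forall>\<theta>\<in>Delta_hom m n. \<forall>w\<in>S n. compose {..m} w \<theta> \<in> S m)"

lemma countable_words: "countable words"
  unfolding words_def
proof (intro countable_UN)
  fix n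
  have "inj_on (\<lambda>w. map w [0..<Suc n]) ({..n} \<rightarrow>\<^sub>E (UNIV :: nat set))"
  proof (intro inj_onI PiE_ext)
    fix v w :: "nat \<Rightarrow> nat" and i
    assume "map v [0..<Suc n] = map w [0..<Suc n]" "i \<in> {..n}"
    then show "v i = w i" by (simp only: map_eq_conv set_upt) simp
  qed
  then show "countable ({..n} \<rightarrow>\<^sub>E (UNIV :: nat set))"
    by (rule countable_image_inj_on[rotated]) simp
qed simp

lemma word_complex_words: "word_complex S \<Longrightarrow> w \<in> S n \<Longrightarrow> w \<in> words"
  by (auto simp: word_complex_def words_def)

lemma word_complex_compose:
  "word_complex S \<Longrightarrow> w \<in> S n \<Longrightarrow> \<theta> \<in> Delta_hom m n \<Longrightarrow> compose {..m} w \<theta> \<in> S m"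
  by (auto simp: word_complex_def)

lemma compose_word_id: "w \<in> {..n} \<rightarrow>\<^sub>E UNIV \<Longrightarrow> compose {..n} w (Delta_id n) = w"
  by (auto simp: compose_def Delta_id_def fun_eq_iff PiE_iff extensional_def)

lemma simplices_std_simplex: "simplices (std_simplex n) m = Delta_hom m n"
  by (simp add: std_simplex_def)

lemma simplices_horn:
  "simplices (horn n k) m = {\<theta> \<in> Delta_hom m n. \<exists>i\<le>n. i \<noteq> k \<and> i \<notin> \<theta> ` {..m}}"
  by (simp add: horn_def)

lemma word_complex_std_simplex: "word_complex (simplices (std_simplex n))"
  by (auto simp: word_complex_def simplices_std_simplex Delta_hom_compose)
     (auto simp: Delta_hom_def PiE_iff extensional_def)

lemma word_complex_horn: "word_complex (simplices (horn n k))"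
  unfolding word_complex_def
proof (intro conjI allI ballI)
  show "simplices (horn n k) m \<subseteq> {..m} \<rightarrow>\<^sub>E UNIV" for m
    by (auto simp: simplices_horn Delta_hom_def PiE_iff extensional_def)
  fix l m \<eta> \<theta> assume "\<eta> \<in> Delta_hom l m" "\<theta> \<in> simplices (horn n k) m"
  from simplicial_set_act[OF simplicial_set_horn this]
  show "compose {..l} \<theta> \<eta> \<in> simplices (horn n k) l" by (simp add: horn_def)
qed

locale word_coding =
  fixes code :: "(nat \<Rightarrow> nat) \<Rightarrow> 'u"
  assumes inj_code: "inj_on code words"
begin

definition decode :: "'u \<Rightarrow> nat \<Rightarrow> nat" where
  "decode = inv_into words code"

definition coded :: "(nat \<Rightarrow> (nat \<Rightarrow> nat) set) \<Rightarrow> 'u sset" where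
  "coded S = \<lparr>simplices = (\<lambda>n. code ` S n),
              act = (\<lambda>m n \<theta> u. code (compose {..m} (decode u) \<theta>))\<rparr>"

lemma decode_code: "w \<in> words \<Longrightarrow> decode (code w) = w"
  by (simp add: decode_def inv_into_f_f[OF inj_code])

lemma simplices_coded: "simplices (coded S) n = code ` S n"
  by (simp add: coded_def)

lemma act_coded: "w \<in> words \<Longrightarrow> act (coded S) m n \<theta> (code w) = code (compose {..m} w \<theta>)"
  by (simp add: coded_def decode_code)

lemma simplicial_set_coded:
  assumes S: "word_complex S" shows "simplicial_set (coded S)"
  unfolding simplicial_set_def
proof (intro conjI allI ballI)
  fix l m n \<eta> \<theta> x
  assume \<theta>: "\<theta> \<in> Delta_hom m n" and "x \<in> simplices (coded S) n"
  then obtain w where w: "w \<in> S n" "x = code w" by (auto simp: simplices_coded)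
  have c: "compose {..m} w \<theta> \<in> S m" using word_complex_compose[OF S w(1) \<theta>] .
  then show "act (coded S) m n \<theta> x \<in> simplices (coded S) m"
    using w word_complex_words[OF S w(1)] by (simp add: act_coded simplices_coded)
  assume "\<eta> \<in> Delta_hom l m"
  then show "act (coded S) l n (compose {..l} \<theta> \<eta>) x = act (coded S) l m \<eta> (act (coded S) m n \<theta> x)"
    using w word_complex_words[OF S w(1)] word_complex_words[OF S c]
    by (simp add: act_coded Delta_compose_assoc)
next
  fix n x assume "x \<in> simplices (coded S) n"
  then obtain w where w: "w \<in> S n" "x = code w" by (auto simp: simplices_coded)
  have "w \<in> {..n} \<rightarrow>\<^sub>E UNIV" using S w(1) by (auto simp: word_complex_def)
  then show "act (coded S) n n (Delta_id n) x = x"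
    using w word_complex_words[OF S w(1)] by (simp add: act_coded compose_word_id)
qed

lemma code_mem_iff:
  assumes "word_complex S" "w \<in> words" shows "code w \<in> code ` S n \<longleftrightarrow> w \<in> S n"
proof -
  have "S n \<subseteq> words" using word_complex_words[OF assms(1)] by blast
  then show ?thesis by (rule inj_on_image_mem_iff[OF inj_code assms(2)])
qed

lemma subcomplex_coded:
  assumes "word_complex S" "word_complex T" "\<And>n. S n \<subseteq> T n"
  shows "subcomplex (coded S) (coded T)"
  using assms by (auto simp: subcomplex_iff simplicial_set_coded simplices_coded)
    (auto simp: coded_def)

text \<open>
  Standard simplices and horns live over the fixed type of functions on the natural numbers; this
  provides isomorphic copies of them over the universe.
\<close>

lemma sset_iso_coded:
  assumes X: "simplicial_set X" and S: "word_complex (simplices X)"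
    and act: "\<And>l m \<eta> \<theta>. act X l m \<eta> \<theta> = compose {..l} \<theta> \<eta>"
  shows "sset_iso X (coded (simplices X)) (\<lambda>m. restrict code (simplices X m))"
  unfolding sset_iso_def
proof (intro conjI bexI)
  let ?c = "\<lambda>m. restrict code (simplices X m)"
  let ?d = "\<lambda>m. restrict decode (code ` simplices X m)"
  have wd: "w \<in> words" if "w \<in> simplices X n" for w n
    using word_complex_words[OF S that] .
  have cl: "compose {..m} w \<theta> \<in> simplices X m"
    if "\<theta> \<in> Delta_hom m n" "w \<in> simplices X n" for w m n \<theta>
    using word_complex_compose[OF S that(2,1)] .
  have code_inj: "w = v" if "v \<in> simplices X n" "w \<in> simplices X n" "code v = code w" for v w n
    using that wd inj_onD[OF inj_code] by metis
  show c: "?c \<in> sset_hom X (coded (simplices X))"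
    by (rule sset_homI)
      (auto simp: X simplicial_set_coded S simplices_coded act act_coded wd cl)
  show d: "?d \<in> sset_hom (coded (simplices X)) X"
    by (rule sset_homI)
      (auto simp: X simplicial_set_coded S simplices_coded act act_coded wd cl decode_code
        dest: code_inj[OF cl])
  show "smap_comp X ?d ?c = smap_id X"
    by (auto simp: smap_comp_def smap_id_def compose_def fun_eq_iff decode_code wd)
  show "smap_comp (coded (simplices X)) ?c ?d = smap_id (coded (simplices X))"
    by (auto simp: smap_comp_def smap_id_def compose_def fun_eq_iff decode_code wd simplices_coded)
qed

lemma inner_horn_inclusion_coded:
  assumes "0 < k" "k < n"
  shows "inner_horn_inclusion (coded (simplices (horn n k))) (coded (simplices (std_simplex n)))
    (smap_id (coded (simplices (horn n k))))"
  unfolding inner_horn_inclusion_def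
proof (intro conjI exI)
  have sub: "simplices (horn n k) m \<subseteq> simplices (std_simplex n) m" for m
    by (auto simp: simplices_horn simplices_std_simplex)
  show "smap_id (coded (simplices (horn n k)))
      \<in> sset_hom (coded (simplices (horn n k))) (coded (simplices (std_simplex n)))"
    using subcomplex_coded[OF word_complex_horn word_complex_std_simplex sub]
    by (simp add: subcomplex_def)
  show "sset_iso (horn n k) (coded (simplices (horn n k)))
      (\<lambda>m. restrict code (simplices (horn n k) m))"
    by (rule sset_iso_coded[OF simplicial_set_horn word_complex_horn]) (simp add: horn_def)
  show "sset_iso (std_simplex n) (coded (simplices (std_simplex n)))
      (\<lambda>m. restrict code (simplices (std_simplex n) m))"
    by (rule sset_iso_coded[OF simplicial_set_std_simplex word_complex_std_simplex])
      (simp add: std_simplex_def)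
  show "smap_comp (horn n k) (smap_id (coded (simplices (horn n k))))
        (\<lambda>m. restrict code (simplices (horn n k) m))
      = smap_comp (horn n k) (\<lambda>m. restrict code (simplices (std_simplex n) m))
        (smap_id (horn n k))"
    using sub by (fastforce simp: smap_comp_def smap_id_def compose_def fun_eq_iff simplices_coded)
qed (use assms in auto)

text \<open>
  The Yoneda map of the \<open>n\<close>-simplex \<open>z\<close>. The word \<open>z\<close> may continue beyond position \<open>n\<close>, so that
  the prefixes of one infinite word classify simplices of all dimensions.
\<close>

lemma word_map_hom:
  assumes S: "word_complex S"
    and z: "\<And>m \<theta>. \<theta> \<in> Delta_hom m n \<Longrightarrow> compose {..m} z \<theta> \<in> S m"
  shows "(\<lambda>m. \<lambda>u\<in>code ` Delta_hom m n. code (compose {..m} z (decode u)))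
    \<in> sset_hom (coded (simplices (std_simplex n))) (coded S)"
proof (rule sset_homI)
  have wd: "\<theta> \<in> words" if "\<theta> \<in> Delta_hom m n" for m \<theta>
    using word_complex_words[OF word_complex_std_simplex] that by (simp add: simplices_std_simplex)
  show "(\<lambda>u\<in>code ` Delta_hom m n. code (compose {..m} z (decode u)))
      \<in> extensional (simplices (coded (simplices (std_simplex n))) m)" for m
    by (simp add: simplices_coded simplices_std_simplex)
  show "(\<lambda>u\<in>code ` Delta_hom m n. code (compose {..m} z (decode u))) x \<in> simplices (coded S) m"
    if "x \<in> simplices (coded (simplices (std_simplex n))) m" for m x
    using that z by (auto simp: simplices_coded simplices_std_simplex decode_code wd)
  fix l m \<eta> x
  assume \<eta>: "\<eta> \<in> Delta_hom l m" and "x \<in> simplices (coded (simplices (std_simplex n))) m"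
  then obtain \<theta> where \<theta>: "\<theta> \<in> Delta_hom m n" "x = code \<theta>"
    by (auto simp: simplices_coded simplices_std_simplex)
  have "compose {..m} z \<theta> \<in> words" using word_complex_words[OF S z[OF \<theta>(1)]] .
  then show "(\<lambda>u\<in>code ` Delta_hom l n. code (compose {..l} z (decode u)))
        (act (coded (simplices (std_simplex n))) l m \<eta> x)
      = act (coded S) l m \<eta> ((\<lambda>u\<in>code ` Delta_hom m n. code (compose {..m} z (decode u))) x)"
    using \<theta> Delta_hom_compose[OF \<eta> \<theta>(1)]
    by (simp add: act_coded wd decode_code Delta_compose_assoc[OF \<eta>])
qed (use S in \<open>auto simp: simplicial_set_coded word_complex_std_simplex\<close>)

text \<open>
  Adding one simplex \<open>z\<close> is a pushout of a horn inclusion if exactly the horn of \<open>z\<close> was present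
  before and no two of the added simplices are identified.
\<close>

lemma inner_anodyne_attach_simplex:
  assumes S: "word_complex S" and T: "word_complex T" and k: "0 < k" "k < n"
    and T_eq: "\<And>m. T m = S m \<union> (\<lambda>\<theta>. compose {..m} z \<theta>) ` Delta_hom m n"
    and horn: "\<And>m \<theta>. \<theta> \<in> Delta_hom m n \<Longrightarrow>
        compose {..m} z \<theta> \<in> S m \<longleftrightarrow> \<theta> \<in> simplices (horn n k) m"
    and inj: "\<And>m. inj_on (\<lambda>\<theta>. compose {..m} z \<theta>) (Delta_hom m n - simplices (horn n k) m)"
  shows "inner_anodyne (coded S) (coded T) (smap_id (coded S))"
proof -
  let ?D = "coded (simplices (std_simplex n))" and ?H = "coded (simplices (horn n k))"
  let ?v = "\<lambda>m. \<lambda>u\<in>code ` Delta_hom m n. code (compose {..m} z (decode u))"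
  have wd: "\<theta> \<in> words" if "\<theta> \<in> Delta_hom m n" for m \<theta>
    using word_complex_words[OF word_complex_std_simplex] that by (simp add: simplices_std_simplex)
  have wz: "compose {..m} z \<theta> \<in> words" if "\<theta> \<in> Delta_hom m n" for m \<theta>
    using T_eq[of m] that by (intro word_complex_words[OF T, of _ m]) auto
  have v: "?v \<in> sset_hom ?D (coded T)"
    by (rule word_map_hom[OF T]) (auto simp: T_eq)
  have v_code: "?v m (code \<theta>) = code (compose {..m} z \<theta>)" if "\<theta> \<in> Delta_hom m n" for m \<theta>
    using that by (simp add: decode_code wd)
  have "is_pushout ?H ?D (coded S) (coded T) (smap_id ?H) (smap_comp ?H ?v (smap_id ?H)) ?v
      (smap_id (coded S))"
  proof (rule pushout_of_relative_bijection[OF _ _ v])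
    show "subcomplex ?H ?D"
      by (rule subcomplex_coded[OF word_complex_horn word_complex_std_simplex])
        (auto simp: simplices_horn simplices_std_simplex)
    show "subcomplex (coded S) (coded T)"
      by (rule subcomplex_coded[OF S T]) (simp add: T_eq)
    show "simplices (coded T) m \<subseteq> simplices (coded S) m \<union> ?v m ` simplices ?D m" for m
    proof
      fix x assume "x \<in> simplices (coded T) m"
      then consider "x \<in> code ` S m" | \<theta> where "\<theta> \<in> Delta_hom m n" "x = code (compose {..m} z \<theta>)"
        by (auto simp: simplices_coded T_eq)
      then show "x \<in> simplices (coded S) m \<union> ?v m ` simplices ?D m"
      proof cases
        case 2
        then have "x = ?v m (code \<theta>)" by (simp only: v_code)
        then show ?thesis using 2(1) unfolding simplices_coded simplices_std_simplex by blast
      qed (simp add: simplices_coded)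
    qed
    show "?v m x \<in> simplices (coded S) m \<longleftrightarrow> x \<in> simplices ?H m" if "x \<in> simplices ?D m" for m x
    proof -
      obtain \<theta> where \<theta>: "\<theta> \<in> Delta_hom m n" "x = code \<theta>"
        using \<open>x \<in> simplices ?D m\<close> by (auto simp: simplices_coded simplices_std_simplex)
      show ?thesis
        unfolding \<theta>(2) v_code[OF \<theta>(1)] simplices_coded code_mem_iff[OF S wz[OF \<theta>(1)]]
          code_mem_iff[OF word_complex_horn wd[OF \<theta>(1)]] by (rule horn[OF \<theta>(1)])
    qed
    show "inj_on (?v m) (simplices ?D m - simplices ?H m)" for m
    proof (rule inj_onI)
      fix x y assume x: "x \<in> simplices ?D m - simplices ?H m"
        and y: "y \<in> simplices ?D m - simplices ?H m" and eq: "?v m x = ?v m y"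
      obtain \<theta> \<eta> where \<theta>: "\<theta> \<in> Delta_hom m n - simplices (horn n k) m" "x = code \<theta>"
        and \<eta>: "\<eta> \<in> Delta_hom m n - simplices (horn n k) m" "y = code \<eta>"
        using x y by (auto simp: simplices_coded simplices_std_simplex)
      have "code (compose {..m} z \<theta>) = code (compose {..m} z \<eta>)"
        using eq \<theta> \<eta> v_code by simp
      then have "compose {..m} z \<theta> = compose {..m} z \<eta>"
        using inj_onD[OF inj_code] wz \<theta> \<eta> by blast
      then show "x = y" using inj_onD[OF inj[of m]] \<theta> \<eta> by blast
    qed
  qed
  moreover have "inner_anodyne ?H ?D (smap_id ?H)"
    by (rule inner_anodyne_horn[OF inner_horn_inclusion_coded[OF k]])
  ultimately show ?thesis
    using saturated_inner_anodyne[where 'u = 'u]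
    unfolding saturated_def closed_under_pushouts_def by blast
qed

end

section \<open>The zigzag filtrations\<close>

definition zigzag :: "nat \<Rightarrow> nat \<Rightarrow> nat" where
  "zigzag l i = (if i = 0 then 2 else if odd i then l else 1 - l)"

text \<open>
  \<open>Delta_hom m (Suc s)\<close> reaches the positions \<open>0, \<dots>, s + 1\<close> of the zigzag, so \<open>stage l s\<close> contains its
  first \<open>s + 2\<close> letters. The words in \<open>0\<close> and \<open>1\<close> belong to every stage, as the nerve of the
  isomorphism between \<open>0\<close> and \<open>1\<close>.
\<close>

definition stage :: "nat \<Rightarrow> nat \<Rightarrow> nat \<Rightarrow> (nat \<Rightarrow> nat) set" where
  "stage l s m = ({..m} \<rightarrow>\<^sub>E {0, 1}) \<union> (\<lambda>\<theta>. compose {..m} (zigzag l) \<theta>) ` Delta_hom m (Suc s)"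

lemma Delta_homI:
  assumes "\<And>i. i \<le> m \<Longrightarrow> \<theta> i \<le> n" "\<And>i j. i \<le> j \<Longrightarrow> j \<le> m \<Longrightarrow> \<theta> i \<le> \<theta> j"
  shows "restrict \<theta> {..m} \<in> Delta_hom m n"
  using assms by (auto simp: Delta_hom_def mono_on_def)

lemma Delta_hom_le: "\<theta> \<in> Delta_hom m n \<Longrightarrow> i \<le> m \<Longrightarrow> \<theta> i \<le> n"
  by (auto simp: Delta_hom_def PiE_iff)

lemma Delta_hom_mono: "\<theta> \<in> Delta_hom m n \<Longrightarrow> i \<le> j \<Longrightarrow> j \<le> m \<Longrightarrow> \<theta> i \<le> \<theta> j"
  by (auto simp: Delta_hom_def mono_on_def)

lemma Delta_hom_weaken: "\<theta> \<in> Delta_hom m n \<Longrightarrow> n \<le> n' \<Longrightarrow> \<theta> \<in> Delta_hom m n'"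
  unfolding Delta_hom_def using PiE_mono[of "{..m}" "\<lambda>_. {..n}" "\<lambda>_. {..n'}"] by auto

lemma compose_words: "compose {..m} w \<theta> \<in> {..m} \<rightarrow>\<^sub>E UNIV"
  by (simp add: compose_def PiE_iff)

lemma zigzag_letter: "l \<le> 1 \<Longrightarrow> i \<noteq> 0 \<Longrightarrow> zigzag l i \<in> {0, 1}"
  by (cases l) (auto simp: zigzag_def)

lemma stageI: "\<theta> \<in> Delta_hom m n \<Longrightarrow> n \<le> Suc s \<Longrightarrow> compose {..m} (zigzag l) \<theta> \<in> stage l s m"
  unfolding stage_def using Delta_hom_weaken by blast

lemma zigzag_add_2: "0 < i \<Longrightarrow> zigzag l (i + 2) = zigzag l i"
  by (simp add: zigzag_def)

lemma zigzag_Suc_neq: "l \<le> 1 \<Longrightarrow> zigzag l (Suc i) \<noteq> zigzag l i"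
  by (cases l) (auto simp: zigzag_def)

lemma word_complex_stage: "word_complex (stage l s)"
  unfolding word_complex_def
proof (intro conjI allI ballI)
  show "stage l s m \<subseteq> {..m} \<rightarrow>\<^sub>E UNIV" for m
    unfolding stage_def by (intro Un_least image_subsetI compose_words PiE_mono) simp
  fix k m \<eta> w assume \<eta>: "\<eta> \<in> Delta_hom k m" and "w \<in> stage l s m"
  then consider "w \<in> {..m} \<rightarrow>\<^sub>E {0, 1}" |
    \<theta> where "\<theta> \<in> Delta_hom m (Suc s)" "w = compose {..m} (zigzag l) \<theta>"
    by (auto simp: stage_def)
  then show "compose {..k} w \<eta> \<in> stage l s k"
  proof cases
    case 1
    have "compose {..k} w \<eta> \<in> {..k} \<rightarrow>\<^sub>E {0, 1}"
      using 1 Delta_hom_le[OF \<eta>] by (auto simp: compose_def PiE_iff)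
    then show ?thesis by (simp add: stage_def)
  next
    case 2
    have "compose {..k} w \<eta> = compose {..k} (zigzag l) (compose {..k} \<theta> \<eta>)"
      using 2 by (simp add: Delta_compose_assoc[OF \<eta>])
    then show ?thesis using stageI[OF Delta_hom_compose[OF \<eta> 2(1)]] by simp
  qed
qed

lemma stage_Suc: "stage l (Suc s) m = stage l s m \<union> (\<lambda>\<theta>. compose {..m} (zigzag l) \<theta>) ` Delta_hom m (s + 2)"
proof -
  have "Delta_hom m (Suc s) \<subseteq> Delta_hom m (Suc (Suc s))" by (auto intro: Delta_hom_weaken)
  then show ?thesis unfolding stage_def add_2_eq_Suc' by blast
qed

lemma stage_mono: "s \<le> t \<Longrightarrow> stage l s m \<subseteq> stage l t m"
  using Delta_hom_weaken[of _ m "Suc s" "Suc t"] unfolding stage_def by blast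

text \<open>
  The zigzag for \<open>l\<close> is the zigzag for \<open>1 - l\<close> with its position \<open>1\<close> omitted.
\<close>

lemma stage_interleave: "stage l s m \<subseteq> stage (1 - l) (Suc s) m" if "l \<le> 1"
proof
  fix w assume "w \<in> stage l s m"
  then consider "w \<in> {..m} \<rightarrow>\<^sub>E {0, 1}" |
    \<theta> where "\<theta> \<in> Delta_hom m (Suc s)" "w = compose {..m} (zigzag l) \<theta>"
    by (auto simp: stage_def)
  then show "w \<in> stage (1 - l) (Suc s) m"
  proof cases
    case 1
    then show ?thesis by (simp add: stage_def)
  next
    case 2
    let ?\<eta> = "\<lambda>i\<in>{..m}. if \<theta> i = 0 then 0 else Suc (\<theta> i)"
    have "?\<eta> \<in> Delta_hom m (Suc (Suc s))"
      by (rule Delta_homI) (use Delta_hom_le[OF 2(1)] Delta_hom_mono[OF 2(1)] in \<open>fastforce+\<close>)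
    moreover have "w = compose {..m} (zigzag (1 - l)) ?\<eta>"
      using that 2(2) by (auto simp: compose_def zigzag_def)
    ultimately show ?thesis using stageI by blast
  qed
qed

text \<open>
  Among all ways of reading a word off the zigzag, one that visits every position up to \<open>n\<close>, except
  possibly \<open>1\<close>, is pointwise least. Whenever such a \<open>\<theta>\<close> rises by one, the letter changes and \<open>\<eta>\<close> has
  to rise too; the only larger rise is from \<open>0\<close> to \<open>2\<close>, where the letter \<open>1 - l\<close> rules out that \<open>\<eta>\<close>
  stops at \<open>0\<close> or \<open>1\<close>.
\<close>

lemma zigzag_lift_least:
  assumes l: "l \<le> 1" and \<theta>: "\<theta> \<in> Delta_hom m n" "\<theta> \<notin> simplices (horn n 1) m"
    and \<eta>: "\<eta> \<in> Delta_hom m n'"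
    and eq: "compose {..m} (zigzag l) \<theta> = compose {..m} (zigzag l) \<eta>"
    and "i \<le> m"
  shows "\<theta> i \<le> \<eta> i"
proof -
  have eq: "zigzag l (\<theta> i) = zigzag l (\<eta> i)" if "i \<le> m" for i
    using fun_cong[OF eq, of i] that by (simp add: compose_def)
  have onto: "\<exists>i\<le>m. \<theta> i = j" if "j \<le> n" "j \<noteq> 1" for j
    using \<theta> that by (auto simp: simplices_horn)
  have gap: "\<theta> (Suc i) \<le> Suc (\<theta> i) \<or> \<theta> i = 0 \<and> \<theta> (Suc i) = 2" if "Suc i \<le> m" for i
  proof (rule ccontr)
    assume not: "\<not> ?thesis"
    \<comment> \<open>a value other than \<open>1\<close> that is jumped over, contrary to the hypothesis on \<open>\<theta>\<close>\<close>
    define j where "j = (if \<theta> i = 0 then 2 else Suc (\<theta> i))"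
    have j: "\<theta> i < j" "j < \<theta> (Suc i)" "j \<noteq> 1" using not by (auto simp: j_def)
    then have "\<exists>i\<le>m. \<theta> i = j"
      using Delta_hom_le[OF \<theta>(1) that] by (intro onto) auto
    then obtain i' where i': "i' \<le> m" "\<theta> i' = j" by blast
    show False
    proof (cases "i' \<le> i")
      case True
      then show ?thesis using Delta_hom_mono[OF \<theta>(1) True] that i' j by auto
    next
      case False
      then show ?thesis using Delta_hom_mono[OF \<theta>(1), of "Suc i" i'] i' j by auto
    qed
  qed
  show ?thesis using \<open>i \<le> m\<close>
  proof (induction i)
    case 0
    obtain i where "i \<le> m" "\<theta> i = 0" using onto[of 0] by auto
    then show ?case using Delta_hom_mono[OF \<theta>(1), of 0 i] by simp
  next
    case (Suc i)
    then have IH: "\<theta> i \<le> \<eta> i" and mono: "\<eta> i \<le> \<eta> (Suc i)" and e: "zigzag l (\<theta> i) = zigzag l (\<eta> i)"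
      and e': "zigzag l (\<theta> (Suc i)) = zigzag l (\<eta> (Suc i))"
      using Delta_hom_mono[OF \<eta>, of i "Suc i"] eq by auto
    consider "\<theta> (Suc i) \<le> \<theta> i" | "\<theta> (Suc i) = Suc (\<theta> i)" | "\<theta> i = 0" "\<theta> (Suc i) = 2"
      using gap[OF Suc.prems] by linarith
    then show ?case
    proof cases
      case 1
      then show ?thesis using IH mono by simp
    next
      case 2
      have "\<eta> (Suc i) \<noteq> \<theta> i"
        using e' 2 zigzag_Suc_neq[OF l, of "\<theta> i"] by auto
      then show ?thesis using IH mono 2 by simp
    next
      case 3
      then have "zigzag l (\<eta> (Suc i)) = 1 - l" using e' by (simp add: zigzag_def)
      moreover have "zigzag l 0 = 2" "zigzag l 1 = l" by (simp_all add: zigzag_def)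
      moreover have "1 - l \<noteq> 2" "1 - l \<noteq> l" using l by arith+
      ultimately have "\<eta> (Suc i) \<noteq> 0" "\<eta> (Suc i) \<noteq> 1" by metis+
      then show ?thesis using 3 by simp
    qed
  qed
qed

text \<open>
  From right to left: a word that omits position \<open>0\<close> has no letter \<open>2\<close>, and a word that omits a
  position \<open>k \<ge> 2\<close> can be read off two positions earlier after \<open>k\<close>. This fails for \<open>k = 1\<close>,
  where the neighbouring letters are \<open>2\<close> and \<open>1 - l\<close>. From left to right: off the horn, the reading
  \<open>\<theta>\<close> is least and reaches position \<open>s + 2\<close>, so no reading stays within the positions up to \<open>s + 1\<close>.
\<close>

lemma compose_zigzag_in_stage_iff:
  assumes l: "l \<le> 1" and \<theta>: "\<theta> \<in> Delta_hom m (s + 2)"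
  shows "compose {..m} (zigzag l) \<theta> \<in> stage l s m \<longleftrightarrow> \<theta> \<in> simplices (horn (s + 2) 1) m"
proof
  assume "\<theta> \<in> simplices (horn (s + 2) 1) m"
  then obtain k where k: "k \<le> s + 2" "k \<noteq> 1" "\<And>i. i \<le> m \<Longrightarrow> \<theta> i \<noteq> k"
    by (auto simp: simplices_horn)
  show "compose {..m} (zigzag l) \<theta> \<in> stage l s m"
  proof (cases "k = 0")
    case True
    then have "compose {..m} (zigzag l) \<theta> \<in> {..m} \<rightarrow>\<^sub>E {0, 1}"
      using k(3) zigzag_letter[OF l] by (auto simp: compose_def)
    then show ?thesis by (simp add: stage_def)
  next
    case False
    \<comment> \<open>the letters on both sides of the omitted one agree, so the positions after it can be
      moved down by two\<close>
    let ?\<eta> = "\<lambda>i\<in>{..m}. if \<theta> i < k then \<theta> i else \<theta> i - 2"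
    have "?\<eta> \<in> Delta_hom m (Suc s)"
    proof (rule Delta_homI)
      fix i assume i: "i \<le> m"
      show "(if \<theta> i < k then \<theta> i else \<theta> i - 2) \<le> Suc s"
        using Delta_hom_le[OF \<theta> i] k(1) by auto
      fix i' assume "i' \<le> i"
      then show "(if \<theta> i' < k then \<theta> i' else \<theta> i' - 2) \<le> (if \<theta> i < k then \<theta> i else \<theta> i - 2)"
        using Delta_hom_mono[OF \<theta> _ i] k(3)[OF i] by fastforce
    qed
    moreover have "zigzag l (\<theta> i) = zigzag l (if \<theta> i < k then \<theta> i else \<theta> i - 2)" if "i \<le> m" for i
    proof (cases "\<theta> i < k")
      case False
      then have "0 < \<theta> i - 2" "\<theta> i = (\<theta> i - 2) + 2"
        using \<open>k \<noteq> 0\<close> k(2) k(3)[OF that] by auto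
      then show ?thesis using False zigzag_add_2[of "\<theta> i - 2" l] by simp
    qed simp
    then have "compose {..m} (zigzag l) \<theta> = compose {..m} (zigzag l) ?\<eta>"
      by (auto simp: compose_def)
    ultimately show ?thesis using stageI by simp
  qed
next
  assume "compose {..m} (zigzag l) \<theta> \<in> stage l s m"
  then consider "compose {..m} (zigzag l) \<theta> \<in> {..m} \<rightarrow>\<^sub>E {0, 1}" |
    \<eta> where "\<eta> \<in> Delta_hom m (Suc s)" "compose {..m} (zigzag l) \<theta> = compose {..m} (zigzag l) \<eta>"
    by (auto simp: stage_def)
  then show "\<theta> \<in> simplices (horn (s + 2) 1) m"
  proof cases
    case 1
    have "\<theta> i \<noteq> 0" if "i \<le> m" for i
    proof
      assume "\<theta> i = 0"
      then have "compose {..m} (zigzag l) \<theta> i = 2" using that by (simp add: compose_def zigzag_def)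
      then show False using PiE_mem[OF 1, of i] that by simp
    qed
    then show ?thesis using \<theta> by (force simp: simplices_horn)
  next
    case 2
    show ?thesis
    proof (rule ccontr)
      assume not: "\<theta> \<notin> simplices (horn (s + 2) 1) m"
      have "\<exists>i\<le>m. \<theta> i = s + 2" using not \<theta> by (force simp: simplices_horn)
      then obtain i where "i \<le> m" "\<theta> i = s + 2" by blast
      then show False
        using zigzag_lift_least[OF l \<theta> not 2, of i] Delta_hom_le[OF 2(1), of i] by simp
    qed
  qed
qed

lemma compose_zigzag_inj_off_horn:
  assumes "l \<le> 1"
  shows "inj_on (\<lambda>\<theta>. compose {..m} (zigzag l) \<theta>) (Delta_hom m n - simplices (horn n 1) m)"
proof (rule inj_onI)
  fix \<theta> \<eta>
  assume \<theta>: "\<theta> \<in> Delta_hom m n - simplices (horn n 1) m"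
    and \<eta>: "\<eta> \<in> Delta_hom m n - simplices (horn n 1) m"
    and eq: "compose {..m} (zigzag l) \<theta> = compose {..m} (zigzag l) \<eta>"
  have "\<theta> i = \<eta> i" if "i \<le> m" for i
    using zigzag_lift_least[OF assms _ _ _ eq that, of n n]
      zigzag_lift_least[OF assms _ _ _ eq[symmetric] that, of n n] \<theta> \<eta> by (simp add: antisym)
  then show "\<theta> = \<eta>"
    using \<theta> \<eta> by (intro PiE_ext[of \<theta> "{..m}" "\<lambda>_. {..n}" \<eta>]) (auto simp: Delta_hom_def)
qed

definition zigzag_complex :: "nat \<Rightarrow> (nat \<Rightarrow> nat) set" where
  "zigzag_complex m = (\<Union>s. stage 0 s m)"

lemma zigzag_complex_eq:
  assumes "l \<le> 1" shows "zigzag_complex m = (\<Union>s. stage l s m)"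
proof (cases l)
  case (Suc k)
  then have l: "l = 1" using assms by simp
  have "stage 0 s m \<subseteq> stage 1 (Suc s) m" "stage 1 s m \<subseteq> stage 0 (Suc s) m" for s
    using stage_interleave[of 0 s m] stage_interleave[of 1 s m] by auto
  then show ?thesis unfolding zigzag_complex_def l by blast
qed (simp add: zigzag_complex_def)

lemma word_complex_Union:
  assumes "\<And>s. word_complex (S s)" shows "word_complex (\<lambda>m. \<Union>s. S s m)"
  unfolding word_complex_def
proof (intro conjI allI ballI)
  show "(\<Union>s. S s m) \<subseteq> {..m} \<rightarrow>\<^sub>E UNIV" for m
    using assms by (intro UN_least) (simp add: word_complex_def)
  fix m n \<theta> w assume \<theta>: "\<theta> \<in> Delta_hom m n" and "w \<in> (\<Union>s. S s n)"
  then obtain s where "w \<in> S s n" by blast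
  from word_complex_compose[OF assms this \<theta>] show "compose {..m} w \<theta> \<in> (\<Union>s. S s m)" by blast
qed

lemma word_complex_zigzag_complex: "word_complex zigzag_complex"
  unfolding zigzag_complex_def[abs_def] by (rule word_complex_Union) (rule word_complex_stage)

context word_coding
begin

lemma inner_anodyne_stage_Suc:
  assumes "l \<le> 1"
  shows "inner_anodyne (coded (stage l s)) (coded (stage l (Suc s))) (smap_id (coded (stage l s)))"
  by (rule inner_anodyne_attach_simplex[where n = "s + 2" and k = 1 and z = "zigzag l"])
    (use assms in \<open>simp_all add: word_complex_stage stage_Suc compose_zigzag_in_stage_iff
      compose_zigzag_inj_off_horn del: One_nat_def\<close>)

lemma inner_anodyne_stage_zigzag_complex:
  assumes inf: "infinite (UNIV :: 'u set)" and l: "l \<le> 1"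
  shows "inner_anodyne (coded (stage l s)) (coded zigzag_complex) (smap_id (coded (stage l s)))"
proof -
  let ?X = "\<lambda>i. coded (stage l (s + i))"
  have "inner_anodyne (?X 0) (coded zigzag_complex) (smap_id (?X 0))"
  proof (rule inner_anodyne_filtration[OF inf])
    show "subcomplex (?X i) (coded zigzag_complex)" for i
      by (intro subcomplex_coded word_complex_stage word_complex_zigzag_complex)
        (use zigzag_complex_eq[OF l] in blast)
    show "inner_anodyne (?X i) (?X (Suc i)) (smap_id (?X i))" for i
      using inner_anodyne_stage_Suc[OF l] by simp
    have "stage l i n \<subseteq> stage l (s + i) n" for i n by (rule stage_mono) simp
    then show "simplices (coded zigzag_complex) n \<subseteq> (\<Union>i. simplices (?X i) n)" for n
      unfolding simplices_coded zigzag_complex_eq[OF l] by blast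
  qed
  then show ?thesis by simp
qed

end

section \<open>The inclusion that is not inner anodyne\<close>

lemma small_stages: "stage 0 0 m \<subseteq> stage 1 1 m"
  using stage_interleave[of 0 0 m] by simp

text \<open>
  The positions \<open>0\<close> and \<open>2\<close> of the zigzag \<open>2, 1, 0\<close> carry the letters of the edge \<open>20\<close>, which is why
  halving the positions turns a reading that avoids \<open>1\<close> into one from the other zigzag.
\<close>

lemma mem_stage_0_iff:
  assumes w: "w \<in> stage 1 1 m"
  shows "w \<in> stage 0 0 m \<longleftrightarrow> w 0 \<noteq> 2 \<or> (\<forall>i\<le>m. w i \<noteq> 1)"
proof
  assume "w \<in> stage 0 0 m"
  then consider "w \<in> {..m} \<rightarrow>\<^sub>E {0, 1}" |
    \<theta> where "\<theta> \<in> Delta_hom m 1" "w = compose {..m} (zigzag 0) \<theta>"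
    by (auto simp: stage_def)
  then show "w 0 \<noteq> 2 \<or> (\<forall>i\<le>m. w i \<noteq> 1)"
  proof cases
    case 1
    then show ?thesis using PiE_mem[OF 1, of 0] by auto
  next
    case 2
    have "w i \<noteq> 1" if "i \<le> m" for i
      using Delta_hom_le[OF 2(1) that] 2(2) that by (auto simp: compose_def zigzag_def)
    then show ?thesis by blast
  qed
next
  assume R: "w 0 \<noteq> 2 \<or> (\<forall>i\<le>m. w i \<noteq> 1)"
  consider "w \<in> {..m} \<rightarrow>\<^sub>E {0, 1}" |
    \<theta> where "\<theta> \<in> Delta_hom m 2" "w = compose {..m} (zigzag 1) \<theta>"
    using w by (auto simp: stage_def numeral_2_eq_2)
  then show "w \<in> stage 0 0 m"
  proof cases
    case 1
    then show ?thesis by (simp add: stage_def)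
  next
    case 2
    have w_eq: "w i = zigzag 1 (\<theta> i)" if "i \<le> m" for i using 2 that by (simp add: compose_def)
    show ?thesis
    proof (cases "w 0 = 2")
      case False
      then have "\<theta> 0 \<noteq> 0" using w_eq[of 0] by (auto simp: zigzag_def split: if_splits)
      then have "\<theta> i \<noteq> 0" if "i \<le> m" for i using Delta_hom_mono[OF 2(1), of 0 i] that by auto
      then have "w \<in> {..m} \<rightarrow>\<^sub>E {0, 1}"
        using 2(2) zigzag_letter[of 1] by (auto simp: compose_def)
      then show ?thesis by (simp add: stage_def)
    next
      case True
      let ?\<eta> = "\<lambda>i\<in>{..m}. \<theta> i div 2"
      have not1: "\<theta> i \<noteq> 1" if "i \<le> m" for i
        using True R w_eq[OF that] that by (auto simp: zigzag_def split: if_splits)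
      have "?\<eta> \<in> Delta_hom m 1"
        by (rule Delta_homI)
          (use div_le_mono[OF Delta_hom_le[OF 2(1)], of _ 2] div_le_mono[OF Delta_hom_mono[OF 2(1)]]
            in simp_all)
      moreover have "zigzag 1 (\<theta> i) = zigzag 0 (\<theta> i div 2)" if "i \<le> m" for i
      proof -
        have "\<theta> i = 0 \<or> \<theta> i = 2" using Delta_hom_le[OF 2(1) that] not1[OF that] by linarith
        then show ?thesis by (auto simp: zigzag_def)
      qed
      then have "w = compose {..m} (zigzag 0) ?\<eta>" using 2(2) by (auto simp: compose_def)
      ultimately show ?thesis using stageI[of ?\<eta> m 1 0 0] by simp
    qed
  qed
qed

definition skip :: "nat \<Rightarrow> nat \<Rightarrow> nat \<Rightarrow> nat" where
  "skip m k = (\<lambda>i\<in>{..m}. if i < k then i else Suc i)"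

lemma skip_in_horn:
  assumes "k \<le> Suc m" "k \<noteq> j" shows "skip m k \<in> simplices (horn (Suc m) j) m"
proof -
  have "skip m k \<in> Delta_hom m (Suc m)" unfolding skip_def by (rule Delta_homI) auto
  moreover have "k \<notin> skip m k ` {..m}" by (auto simp: skip_def split: if_splits)
  ultimately show ?thesis using assms by (auto simp: simplices_horn)
qed

text \<open>
  A word outside \<open>stage 0 0\<close> starts with \<open>2\<close> and contains a \<open>1\<close>. Deleting the last position keeps
  both letters unless the only \<open>1\<close> is the last letter; in that case the word is \<open>2\<dots>21\<close>, and
  deleting the first position keeps both.
\<close>

lemma inner_horn_detects_stage_0:
  assumes j: "0 < j" "j < n" and w: "w \<in> stage 1 1 n"
    and faces: "\<And>m \<theta>. \<theta> \<in> simplices (horn n j) m \<Longrightarrow> compose {..m} w \<theta> \<in> stage 0 0 m"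
  shows "w \<in> stage 0 0 n"
proof (rule ccontr)
  assume "w \<notin> stage 0 0 n"
  then obtain p where w0: "w 0 = 2" and p: "p \<le> n" "w p = 1"
    using mem_stage_0_iff[OF w] by blast
  obtain m where n: "n = Suc m" "0 < m" using j by (cases n) auto
  have face: "w (skip m k 0) \<noteq> 2 \<or> (\<forall>i\<le>m. w (skip m k i) \<noteq> 1)" if "k \<le> n" "k \<noteq> j" for k
  proof -
    have "compose {..m} w (skip m k) \<in> stage 0 0 m"
      using skip_in_horn[of k m j] that n by (intro faces) simp
    then show ?thesis
      using mem_stage_0_iff[of "compose {..m} w (skip m k)" m] small_stages
      by (auto simp: compose_def)
  qed
  \<comment> \<open>the face opposite to the last vertex\<close>
  have last: "w i \<noteq> 1" if "i \<le> m" for i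
    using face[of n] j n w0 that by (auto simp: skip_def)
  then have "p = Suc m" using p n by (metis le_SucE)
  \<comment> \<open>the face opposite to the first vertex\<close>
  then have "w (Suc 0) \<noteq> 2"
    using face[of 0] j n p by (auto simp: skip_def)
  moreover obtain \<theta> where \<theta>: "\<theta> \<in> Delta_hom n 2" "w = compose {..n} (zigzag 1) \<theta>"
  proof -
    have "w \<notin> {..n} \<rightarrow>\<^sub>E {0, 1}" using w0 PiE_mem[of w "{..n}" "\<lambda>_. {0, 1}" 0] by auto
    then show ?thesis using w that by (auto simp: stage_def numeral_2_eq_2)
  qed
  moreover have "w (Suc 0) \<noteq> 1" using last n by simp
  \<comment> \<open>the second letter is \<open>0\<close>, after which no \<open>1\<close> can follow\<close>
  ultimately have "\<theta> (Suc 0) = 2"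
    using Delta_hom_le[OF \<theta>(1), of "Suc 0"] n by (auto simp: compose_def zigzag_def split: if_splits)
  then have "\<theta> p = 2"
    using Delta_hom_mono[OF \<theta>(1), of "Suc 0" p] Delta_hom_le[OF \<theta>(1), of p] p n \<open>p = Suc m\<close> by simp
  then show False using p \<theta>(2) by (simp add: compose_def zigzag_def)
qed

context word_coding
begin

text \<open>
  A map out of the standard simplex amounts to the simplex \<open>w\<close> that is the image of the identity,
  and it carries the horn into \<open>stage 0 0\<close> exactly if the corresponding faces of \<open>w\<close> lie there.
\<close>

lemma inner_horn_orthogonal:
  fixes A B :: "'u sset"
  assumes "inner_horn_inclusion A B f"
  shows "orthogonal (coded (stage 0 0)) (coded (stage 1 1)) A B f"
  unfolding orthogonal_def
proof (intro conjI ballI impI)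
  let ?S = "coded (stage 0 0)" and ?T = "coded (stage 1 1)"
  have ST: "subcomplex ?S ?T"
    by (intro subcomplex_coded word_complex_stage small_stages)
  obtain n j \<phi> \<psi> where f: "f \<in> sset_hom A B" and j: "0 < j" "j < n"
    and \<phi>: "sset_iso (horn n j) A \<phi>" and \<psi>: "sset_iso (std_simplex n) B \<psi>"
    and sq: "smap_comp (horn n j) f \<phi> = smap_comp (horn n j) \<psi> (smap_id (horn n j))"
    using assms by (auto simp: inner_horn_inclusion_def)
  show "f \<in> sset_hom A B" by fact
  fix g assume g: "g \<in> sset_hom B ?T" and gf: "smap_comp A g f \<in> sset_hom A ?S"
  have \<phi>m: "\<phi> \<in> sset_hom (horn n j) A" and \<psi>m: "\<psi> \<in> sset_hom (std_simplex n) B"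
    using \<phi> \<psi> by (auto simp: sset_iso_def)
  have g\<psi>: "smap_comp (std_simplex n) g \<psi> \<in> sset_hom (std_simplex n) ?T"
    using \<psi>m g by (rule smap_comp_hom)
  have id_n: "Delta_id n \<in> simplices (std_simplex n) n"
    unfolding simplices_std_simplex Delta_id_def by (rule Delta_homI) auto
  obtain w where w: "w \<in> stage 1 1 n" "g n (\<psi> n (Delta_id n)) = code w"
    using sset_hom_mem[OF g\<psi> id_n] id_n by (auto simp: smap_comp_apply simplices_coded)
  have classify: "g m (\<psi> m \<theta>) = code (compose {..m} w \<theta>)" if \<theta>: "\<theta> \<in> Delta_hom m n" for m \<theta>
  proof -
    have ext: "\<theta> \<in> {..m} \<rightarrow>\<^sub>E {..n}" using \<theta> by (simp add: Delta_hom_def)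
    have "act (std_simplex n) m n \<theta> (Delta_id n) = \<theta>"
      using ext by (auto simp: std_simplex_def compose_def Delta_id_def fun_eq_iff PiE_iff extensional_def)
    then have "g m (\<psi> m \<theta>) = smap_comp (std_simplex n) g \<psi> m (act (std_simplex n) m n \<theta> (Delta_id n))"
      using \<theta> by (simp add: smap_comp_apply simplices_std_simplex)
    also have "\<dots> = act ?T m n \<theta> (code w)"
      using sset_hom_act[OF g\<psi> \<theta> id_n] id_n w by (simp add: smap_comp_apply)
    finally show ?thesis using word_complex_words[OF word_complex_stage w(1)] by (simp add: act_coded)
  qed
  have "w \<in> stage 0 0 n"
  proof (rule inner_horn_detects_stage_0[OF j w(1)])
    fix m \<theta> assume \<theta>: "\<theta> \<in> simplices (horn n j) m"
    then have \<theta>': "\<theta> \<in> Delta_hom m n" by (simp add: simplices_horn)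
    have "f m (\<phi> m \<theta>) = \<psi> m \<theta>"
      using fun_cong[OF fun_cong[OF sq, of m], of \<theta>] \<theta> by (simp add: smap_comp_apply smap_id_apply)
    then have "smap_comp A g f m (\<phi> m \<theta>) = code (compose {..m} w \<theta>)"
      using sset_hom_mem[OF \<phi>m \<theta>] classify[OF \<theta>'] by (simp add: smap_comp_apply)
    then have "code (compose {..m} w \<theta>) \<in> code ` stage 0 0 m"
      using sset_hom_mem[OF gf sset_hom_mem[OF \<phi>m \<theta>]] by (simp add: simplices_coded)
    then show "compose {..m} w \<theta> \<in> stage 0 0 m"
      using code_mem_iff[OF word_complex_stage word_complex_words[OF word_complex_stage]]
        word_complex_compose[OF word_complex_stage w(1) \<theta>'] by blast
  qed
  show "g \<in> sset_hom B ?S"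
    unfolding sset_hom_subcomplex_iff[OF ST]
  proof (intro conjI allI ballI)
    fix m x assume x: "x \<in> simplices B m"
    obtain \<chi> where \<chi>: "\<chi> \<in> sset_hom B (std_simplex n)" and inv: "smap_comp B \<psi> \<chi> = smap_id B"
      using \<psi> by (auto simp: sset_iso_def)
    have \<theta>: "\<chi> m x \<in> Delta_hom m n"
      using sset_hom_mem[OF \<chi> x] by (simp add: simplices_std_simplex)
    have "\<psi> m (\<chi> m x) = x"
      using fun_cong[OF fun_cong[OF inv, of m], of x] x by (simp add: smap_comp_apply smap_id_apply)
    then have "g m x = code (compose {..m} w (\<chi> m x))" using classify[OF \<theta>] by simp
    then show "g m x \<in> simplices ?S m"
      using word_complex_compose[OF word_complex_stage \<open>w \<in> stage 0 0 n\<close> \<theta>]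
      by (simp add: simplices_coded)
  qed fact
qed

lemma not_inner_anodyne_stage_0:
  "\<not> inner_anodyne (coded (stage 0 0)) (coded (stage 1 1)) (smap_id (coded (stage 0 0)))"
proof
  let ?S = "coded (stage 0 0)" and ?T = "coded (stage 1 1)"
  have ST: "subcomplex ?S ?T"
    by (intro subcomplex_coded word_complex_stage small_stages)
  assume "inner_anodyne ?S ?T (smap_id ?S)"
  then have orth: "orthogonal ?S ?T ?S ?T (smap_id ?S)"
    using inner_anodyne_least saturated_orthogonal[OF ST] inner_horn_orthogonal by blast
  have T: "smap_id ?T \<in> sset_hom ?T ?T"
    using subcomplex_refl[OF simplicial_set_coded[OF word_complex_stage]] by (simp add: subcomplex_def)
  have "smap_comp ?S (smap_id ?T) (smap_id ?S) \<in> sset_hom ?S ?S"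
    unfolding smap_comp_inclusions[OF ST]
    using subcomplex_refl[OF simplicial_set_coded[OF word_complex_stage]] by (simp add: subcomplex_def)
  then have "smap_id ?T \<in> sset_hom ?T ?S" using orth T by (auto simp: orthogonal_def)
  \<comment> \<open>the edge \<open>2 1\<close> is the image of the first edge of the zigzag and is missing from \<open>stage 0 0\<close>\<close>
  let ?w = "compose {..1} (zigzag 1) (Delta_id 1)"
  have "Delta_id 1 \<in> Delta_hom 1 1" unfolding Delta_id_def by (rule Delta_homI) auto
  then have w: "?w \<in> stage 1 1 1" by (rule stageI) simp
  have "code ?w \<in> simplices ?T 1" using w by (simp add: simplices_coded)
  from sset_hom_mem[OF \<open>smap_id ?T \<in> sset_hom ?T ?S\<close> this]
  have "code ?w \<in> code ` stage 0 0 1"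
    using w by (simp add: smap_id_apply simplices_coded)
  then have "?w \<in> stage 0 0 1"
    using code_mem_iff[OF word_complex_stage word_complex_words[OF word_complex_stage w]] by simp
  then show False
    using mem_stage_0_iff[OF w] by (auto simp: compose_def Delta_id_def zigzag_def)
qed

end

theorem corollary5:
  assumes "infinite (UNIV :: 'u set)"
  shows "\<exists>(A :: 'u sset) (B :: 'u sset) (C :: 'u sset) i j.
           sset_mono A B i \<and> sset_mono B C j \<and>
           inner_anodyne B C j \<and> inner_anodyne A C (smap_comp A j i) \<and>
           \<not> inner_anodyne A B i"
proof -
  obtain e :: "nat \<Rightarrow> 'u" where e: "inj e"
    using infinite_countable_subset[OF assms] by blast
  interpret word_coding "e \<circ> to_nat_on words"
    by unfold_locales
      (use inj_on_to_nat_on[OF countable_words] e in \<open>auto intro: comp_inj_on inj_on_subset\<close>)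
  let ?A = "coded (stage 0 0)" and ?B = "coded (stage 1 1)" and ?C = "coded zigzag_complex"
  have AB: "subcomplex ?A ?B"
    by (intro subcomplex_coded word_complex_stage small_stages)
  have BC: "subcomplex ?B ?C"
    by (intro subcomplex_coded word_complex_stage word_complex_zigzag_complex)
      (use zigzag_complex_eq[of 1] in blast)
  show ?thesis
  proof (intro exI conjI)
    show "sset_mono ?A ?B (smap_id ?A)" by (rule sset_mono_inclusion[OF AB])
    show "sset_mono ?B ?C (smap_id ?B)" by (rule sset_mono_inclusion[OF BC])
    show "inner_anodyne ?B ?C (smap_id ?B)"
      by (rule inner_anodyne_stage_zigzag_complex[OF assms]) simp
    show "inner_anodyne ?A ?C (smap_comp ?A (smap_id ?B) (smap_id ?A))"
      unfolding smap_comp_inclusions[OF AB]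
      by (rule inner_anodyne_stage_zigzag_complex[OF assms]) simp
    show "\<not> inner_anodyne ?A ?B (smap_id ?A)" by (rule not_inner_anodyne_stage_0)
  qed
qed

end
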